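(* Let $P_{X,Y}$ be a primitive. If there exists an embedding $|\psi\rangle$ of $P_{X,Y}$ with $\Delta_\psi(P_{X,Y})=0$ (i.e. a correct two-party quantum protocol for $P_{X,Y}$ that leaks no extra information), then $P_{X,Y}$ is trivial.
   Context: A primitive is a joint distribution $P_{X,Y}$ on finite sets $\mathcal X\times\mathcal Y$. $\mathcal H_A,\mathcal H_B$ have computational bases indexed by $\mathcal X,\mathcal Y$; $\mathcal H_{A'},\mathcal H_{B'}$ are finite-dimensional (possibly trivial) work spaces. For a pure state on $AA'BB'$, $X$ (resp. $Y$) is the outcome of measuring $A$ (resp. $B$) in the computational basis; entropic quantities are evaluated on the state obtained by measuring exactly the registers named by $X$ or $Y$ and tracing out unmentioned registers; $S(P;Q)=S(P)+S(Q)-S(PQ)$ (von Neumann); $I$ is Shannon mutual information. An embedding of $P_{X,Y}$ (the final purified state of a correct protocol) is a pure state with $(X,Y)\sim P_{X,Y}$ and $S(X;YB')=S(XA';Y)=I(X;Y)$; its leakage is $\Delta_\psi(P_{X,Y})=\max\{S(X;BB')-I(X;Y),S(AA';Y)-I(X;Y)\}$. Dependent part: $X\searrow Y:=f_X(X)$ with $f_X(x)=P_{Y|X=x}$. $P_{X,Y}$ is trivial if $H(X\searrow Y\,|\,Y)=0$ ($H$ Shannon entropy). *)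

theory Defs
  imports "HOL-Analysis.Analysis" "HOL-Computational_Algebra.Polynomial"
begin

text \<open>A primitive is a joint distribution P on 'x \<times> 'y (finite types), given as a function.\<close>

definition is_distribution :: "('i::finite \<Rightarrow> real) \<Rightarrow> bool" where
  "is_distribution P \<longleftrightarrow> (\<forall>i. 0 \<le> P i) \<and> (\<Sum>i\<in>UNIV. P i) = 1"

definition shannon_H :: "('i::finite \<Rightarrow> 'v) \<Rightarrow> ('i \<Rightarrow> real) \<Rightarrow> real" where
  "shannon_H g P = - (\<Sum>v\<in>g ` UNIV.
      (\<Sum>w\<in>{w. g w = v}. P w) * log 2 (\<Sum>w\<in>{w. g w = v}. P w))"

definition mutual_info :: "('x::finite \<times> 'y::finite \<Rightarrow> real) \<Rightarrow> real" where
  "mutual_info P = shannon_H fst P + shannon_H snd P - shannon_H id P"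

definition marg_X :: "('x::finite \<times> 'y::finite \<Rightarrow> real) \<Rightarrow> 'x \<Rightarrow> real" where
  "marg_X P x = (\<Sum>y\<in>UNIV. P (x, y))"

text \<open>f_X(x) = P_{Y|X=x} (only relevant for x in the support of P_X).\<close>
definition dep_fun :: "('x::finite \<times> 'y::finite \<Rightarrow> real) \<Rightarrow> 'x \<Rightarrow> ('y \<Rightarrow> real)" where
  "dep_fun P x = (\<lambda>y. P (x, y) / marg_X P x)"

definition dep_cond_entropy :: "('x::finite \<times> 'y::finite \<Rightarrow> real) \<Rightarrow> real" where
  "dep_cond_entropy P = shannon_H (\<lambda>(x, y). (dep_fun P x, y)) P - shannon_H snd P"

definition trivial_primitive :: "('x::finite \<times> 'y::finite \<Rightarrow> real) \<Rightarrow> bool" where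
  "trivial_primitive P \<longleftrightarrow> dep_cond_entropy P = 0"

definition qcharpoly :: "('k::finite \<Rightarrow> 'k \<Rightarrow> complex) \<Rightarrow> complex poly" where
  "qcharpoly \<rho> = det ((\<chi> i j. (if i = j then [:0, 1:] else 0) - [:\<rho> i j:]) :: complex poly ^'k^'k)"

definition eta :: "real \<Rightarrow> real" where
  "eta t = t * log 2 t"

definition vn_entropy :: "('k::finite \<Rightarrow> 'k \<Rightarrow> complex) \<Rightarrow> real" where
  "vn_entropy \<rho> = - (\<Sum>z\<in>{z. poly (qcharpoly \<rho>) z = 0}.
      real (order z (qcharpoly \<rho>)) * eta (Re z))"

text \<open>Reduced state of the pure state psi (on a finite index type 'i, the product of all
  registers): keep the registers \<kappa>, trace out the registers \<tau> (where (\<kappa>,\<tau>) is a bijective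
  decomposition of the index), and measure in the computational basis the (kept) registers \<delta>
  (i.e. dephase: kill coherences between different values of \<delta>).\<close>
definition reduced :: "('i::finite \<Rightarrow> complex) \<Rightarrow> ('i \<Rightarrow> 'k) \<Rightarrow> ('i \<Rightarrow> 't) \<Rightarrow> ('i \<Rightarrow> 'd)
    \<Rightarrow> 'k \<Rightarrow> 'k \<Rightarrow> complex" where
  "reduced \<psi> \<kappa> \<tau> \<delta> k k' = (\<Sum>i\<in>UNIV. \<Sum>j\<in>UNIV.
      if \<kappa> i = k \<and> \<kappa> j = k' \<and> \<tau> i = \<tau> j \<and> \<delta> i = \<delta> j then \<psi> i * cnj (\<psi> j) else 0)"

text \<open>Pure states on A A' B B' are functions on 'x \<times> 'a \<times> 'y \<times> 'b (A, A', B, B').\<close>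
type_synonym ('x, 'a, 'y, 'b) qstate = "'x \<times> 'a \<times> 'y \<times> 'b \<Rightarrow> complex"

definition S_X :: "('x::finite, 'a::finite, 'y::finite, 'b::finite) qstate \<Rightarrow> real" where
  "S_X \<psi> = vn_entropy (reduced \<psi> (\<lambda>(x,a,y,b). x) (\<lambda>(x,a,y,b). (a,y,b)) (\<lambda>(x,a,y,b). x))"
definition S_Y :: "('x::finite, 'a::finite, 'y::finite, 'b::finite) qstate \<Rightarrow> real" where
  "S_Y \<psi> = vn_entropy (reduced \<psi> (\<lambda>(x,a,y,b). y) (\<lambda>(x,a,y,b). (x,a,b)) (\<lambda>(x,a,y,b). y))"
definition S_YB' :: "('x::finite, 'a::finite, 'y::finite, 'b::finite) qstate \<Rightarrow> real" where
  "S_YB' \<psi> = vn_entropy (reduced \<psi> (\<lambda>(x,a,y,b). (y,b)) (\<lambda>(x,a,y,b). (x,a)) (\<lambda>(x,a,y,b). y))"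
definition S_XYB' :: "('x::finite, 'a::finite, 'y::finite, 'b::finite) qstate \<Rightarrow> real" where
  "S_XYB' \<psi> = vn_entropy (reduced \<psi> (\<lambda>(x,a,y,b). (x,y,b)) (\<lambda>(x,a,y,b). a) (\<lambda>(x,a,y,b). (x,y)))"
definition S_XA' :: "('x::finite, 'a::finite, 'y::finite, 'b::finite) qstate \<Rightarrow> real" where
  "S_XA' \<psi> = vn_entropy (reduced \<psi> (\<lambda>(x,a,y,b). (x,a)) (\<lambda>(x,a,y,b). (y,b)) (\<lambda>(x,a,y,b). x))"
definition S_XA'Y :: "('x::finite, 'a::finite, 'y::finite, 'b::finite) qstate \<Rightarrow> real" where
  "S_XA'Y \<psi> = vn_entropy (reduced \<psi> (\<lambda>(x,a,y,b). (x,a,y)) (\<lambda>(x,a,y,b). b) (\<lambda>(x,a,y,b). (x,y)))"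
definition S_BB' :: "('x::finite, 'a::finite, 'y::finite, 'b::finite) qstate \<Rightarrow> real" where
  "S_BB' \<psi> = vn_entropy (reduced \<psi> (\<lambda>(x,a,y,b). (y,b)) (\<lambda>(x,a,y,b). (x,a)) (\<lambda>_. ()))"
definition S_XBB' :: "('x::finite, 'a::finite, 'y::finite, 'b::finite) qstate \<Rightarrow> real" where
  "S_XBB' \<psi> = vn_entropy (reduced \<psi> (\<lambda>(x,a,y,b). (x,y,b)) (\<lambda>(x,a,y,b). a) (\<lambda>(x,a,y,b). x))"
definition S_AA' :: "('x::finite, 'a::finite, 'y::finite, 'b::finite) qstate \<Rightarrow> real" where
  "S_AA' \<psi> = vn_entropy (reduced \<psi> (\<lambda>(x,a,y,b). (x,a)) (\<lambda>(x,a,y,b). (y,b)) (\<lambda>_. ()))"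
definition S_AA'Y :: "('x::finite, 'a::finite, 'y::finite, 'b::finite) qstate \<Rightarrow> real" where
  "S_AA'Y \<psi> = vn_entropy (reduced \<psi> (\<lambda>(x,a,y,b). (x,a,y)) (\<lambda>(x,a,y,b). b) (\<lambda>(x,a,y,b). y))"

definition MI_X_YB' where "MI_X_YB' \<psi> = S_X \<psi> + S_YB' \<psi> - S_XYB' \<psi>"
definition MI_XA'_Y where "MI_XA'_Y \<psi> = S_XA' \<psi> + S_Y \<psi> - S_XA'Y \<psi>"
definition MI_X_BB' where "MI_X_BB' \<psi> = S_X \<psi> + S_BB' \<psi> - S_XBB' \<psi>"
definition MI_AA'_Y where "MI_AA'_Y \<psi> = S_AA' \<psi> + S_Y \<psi> - S_AA'Y \<psi>"

definition outcome_dist :: "('x::finite, 'a::finite, 'y::finite, 'b::finite) qstate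
    \<Rightarrow> ('x \<times> 'y \<Rightarrow> real) \<Rightarrow> bool" where
  "outcome_dist \<psi> P \<longleftrightarrow> (\<forall>x y. (\<Sum>a\<in>UNIV. \<Sum>b\<in>UNIV. (cmod (\<psi> (x, a, y, b)))\<^sup>2) = P (x, y))"

definition is_embedding :: "('x::finite \<times> 'y::finite \<Rightarrow> real)
    \<Rightarrow> ('x, 'a::finite, 'y, 'b::finite) qstate \<Rightarrow> bool" where
  "is_embedding P \<psi> \<longleftrightarrow> (\<Sum>i\<in>UNIV. (cmod (\<psi> i))\<^sup>2) = 1 \<and> outcome_dist \<psi> P
     \<and> MI_X_YB' \<psi> = mutual_info P \<and> MI_XA'_Y \<psi> = mutual_info P"

definition leakage :: "('x::finite \<times> 'y::finite \<Rightarrow> real)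
    \<Rightarrow> ('x, 'a::finite, 'y, 'b::finite) qstate \<Rightarrow> real" where
  "leakage P \<psi> = max (MI_X_BB' \<psi> - mutual_info P) (MI_AA'_Y \<psi> - mutual_info P)"

end

theory Submission
  imports Defs
begin

text \<open>Write \<open>K\<^sub>x\<close> for the unnormalised conditional states of a quantum system given a classical label,
  and \<open>R\<close> for their sum. Measuring a block index \<open>\<beta>\<close> of the system cannot increase the mutual
  information with the label; if it does not decrease it either, then
  \<open>K\<^sub>x = diag(P(x|\<beta>)) R\<close>. The log in the entropies is the integral over \<open>s\<close> of
  \<open>k\<^sup>2/(s k + r)\<close>, and for each \<open>s\<close> the measured expression is the value of a variational problem at
  a particular diagonal matrix, so equality of the integrals forces optimality at \<open>s = 0\<close>.

  Correctness \<open>S(X;YB') = I(X;Y)\<close> thus says that the Gram matrices over \<open>A'\<close> of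
  the vectors \<open>\<psi>(x,_,y,_)\<close> are, for fixed \<open>y\<close>, proportional to a common matrix \<open>T\<close>. Absence of leakage,
  \<open>S(AA';Y) \<le> I(X;Y)\<close>, together with hermiticity says that
  \<open>(P(y'|x) - P(y'|x')) R(xa,x'a') = 0\<close>, so the vectors for \<open>x\<close> and \<open>x'\<close> are orthogonal over
  \<open>B'\<close> as soon as the conditional distributions differ. If \<open>P(x,y)\<close> and \<open>P(x',y)\<close> were both positive,
  the two facts would give \<open>T\<^sup>2 = 0\<close>, hence \<open>T = 0\<close>, a contradiction.\<close>

section \<open>Spectral theorem and von Neumann entropy\<close>

definition cip :: "('k::finite \<Rightarrow> complex) \<Rightarrow> ('k \<Rightarrow> complex) \<Rightarrow> complex" where
  "cip u v = (\<Sum>k\<in>UNIV. cnj (u k) * v k)"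

definition app :: "('k::finite \<Rightarrow> 'k \<Rightarrow> complex) \<Rightarrow> ('k \<Rightarrow> complex) \<Rightarrow> 'k \<Rightarrow> complex" where
  "app K v q = (\<Sum>q'\<in>UNIV. K q q' * v q')"

definition hermitian :: "('k::finite \<Rightarrow> 'k \<Rightarrow> complex) \<Rightarrow> bool" where
  "hermitian K \<longleftrightarrow> (\<forall>q q'. K q' q = cnj (K q q'))"

lemma cip_commute: "cip v u = cnj (cip u v)"
  by (simp add: cip_def mult.commute)

lemma cip_add_right: "cip u (\<lambda>k. v k + w k) = cip u v + cip u w"
  by (simp add: cip_def sum.distrib algebra_simps)

lemma cip_add_left: "cip (\<lambda>k. v k + w k) u = cip v u + cip w u"
  by (simp add: cip_def sum.distrib algebra_simps)

lemma cip_diff_right: "cip u (\<lambda>k. v k - w k) = cip u v - cip u w"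
  by (simp add: cip_def sum_subtractf algebra_simps)

lemma cip_scale_right: "cip u (\<lambda>k. c * v k) = c * cip u v"
  by (simp add: cip_def sum_distrib_left algebra_simps)

lemma cip_scale_left: "cip (\<lambda>k. c * u k) v = cnj c * cip u v"
  by (simp add: cip_def sum_distrib_left algebra_simps)

lemma cip_sum_right: "cip u (\<lambda>k. \<Sum>i\<in>I. f i k) = (\<Sum>i\<in>I. cip u (f i))"
  unfolding cip_def sum_distrib_left by (rule sum.swap)

lemma cip_self: "cip u u = complex_of_real (\<Sum>k\<in>UNIV. (cmod (u k))\<^sup>2)"
  unfolding cip_def of_real_sum
  by (rule sum.cong[OF refl]) (subst complex_norm_square, rule mult.commute)

lemma cip_self_eq_0: "Re (cip u u) = 0 \<Longrightarrow> u k = 0"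
  by (simp add: cip_self sum_nonneg_eq_0_iff)

lemma app_linear: "app K (\<lambda>k. v k + c * w k) = (\<lambda>q. app K v q + c * app K w q)"
  by (auto simp: app_def sum.distrib sum_distrib_left algebra_simps)

lemma app_scale: "app K (\<lambda>k. c * v k) = (\<lambda>q. c * app K v q)"
  by (auto simp: app_def sum_distrib_left algebra_simps)

lemma hermitian_cip:
  assumes "hermitian K"
  shows "cip u (app K v) = cip (app K u) v"
proof -
  have "cip u (app K v) = (\<Sum>q\<in>UNIV. \<Sum>q'\<in>UNIV. cnj (u q) * K q q' * v q')"
    by (simp add: cip_def app_def sum_distrib_left mult.assoc)
  also have "\<dots> = (\<Sum>q'\<in>UNIV. \<Sum>q\<in>UNIV. cnj (u q) * K q q' * v q')"
    by (rule sum.swap)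
  also have "\<dots> = (\<Sum>q'\<in>UNIV. \<Sum>q\<in>UNIV. cnj (u q) * cnj (K q' q) * v q')"
  proof (intro sum.cong refl)
    fix q q' :: 'a
    have "K q q' = cnj (K q' q)" using assms unfolding hermitian_def by blast
    then show "cnj (u q) * K q q' * v q' = cnj (u q) * cnj (K q' q) * v q'" by simp
  qed
  also have "\<dots> = cip (app K u) v"
    by (simp add: cip_def app_def sum_distrib_right sum_distrib_left mult_ac)
  finally show ?thesis .
qed

text \<open>\<open>v k\<close> is the part of the \<open>k\<close>-th standard basis vector orthogonal to the family \<open>e\<close>. Counting
  squared norms replaces dimension arguments: the family extends if it is too small, and is
  complete if it has \<open>CARD('k)\<close> members.\<close>
lemma bessel_count:
  fixes e :: "'i \<Rightarrow> 'k::finite \<Rightarrow> complex"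
  assumes I: "finite I" and on: "\<And>i j. i \<in> I \<Longrightarrow> j \<in> I \<Longrightarrow> cip (e i) (e j) = (if i = j then 1 else 0)"
  defines "v \<equiv> \<lambda>k q. (if q = k then 1 else 0) - (\<Sum>i\<in>I. cnj (e i k) * e i q)"
  shows "i \<in> I \<Longrightarrow> cip (e i) (v k) = 0"
    and "(\<Sum>k\<in>UNIV. cip (v k) (v k)) = of_nat CARD('k) - of_nat (card I)"
proof -
  have cd: "cip u (\<lambda>q. if q = k then 1 else 0) = cnj (u k)" for u and k :: 'k
    by (simp add: cip_def if_distrib cong: if_cong)
  have orth: "cip (e i) (v k) = 0" if "i \<in> I" for i k
  proof -
    have "cip (e i) (v k) = cnj (e i k) - (\<Sum>j\<in>I. cnj (e j k) * cip (e i) (e j))"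
      unfolding v_def cip_diff_right cd cip_sum_right cip_scale_right ..
    also have "(\<Sum>j\<in>I. cnj (e j k) * cip (e i) (e j)) = (\<Sum>j\<in>I. if j = i then cnj (e j k) else 0)"
      by (rule sum.cong) (use on that in auto)
    finally show ?thesis using that I by simp
  qed
  show "i \<in> I \<Longrightarrow> cip (e i) (v k) = 0" by (rule orth)
  have self: "cip (v k) (v k) = 1 - (\<Sum>i\<in>I. e i k * cnj (e i k))" for k
  proof -
    \<comment> \<open>As \<open>v k\<close> is orthogonal to every \<open>e i\<close>, only its
      pairing with the standard basis vector survives.\<close>
    have "cip (v k) (v k) = cip (v k) (\<lambda>q. if q = k then 1 else 0) - (\<Sum>i\<in>I. cnj (e i k) * cip (v k) (e i))"
      by (subst (2) v_def) (simp only: cip_diff_right cip_sum_right cip_scale_right)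
    also have "(\<Sum>i\<in>I. cnj (e i k) * cip (v k) (e i)) = 0"
      by (rule sum.neutral) (metis orth cip_commute complex_cnj_zero mult_zero_right)
    finally show ?thesis by (simp add: cd) (simp add: v_def mult.commute)
  qed
  have "(\<Sum>k\<in>UNIV. \<Sum>i\<in>I. e i k * cnj (e i k)) = (\<Sum>i\<in>I. cip (e i) (e i))"
    unfolding cip_def by (subst sum.swap) (simp add: mult.commute)
  also have "\<dots> = of_nat (card I)" using on by simp
  finally show "(\<Sum>k\<in>UNIV. cip (v k) (v k)) = of_nat CARD('k) - of_nat (card I)"
    by (simp add: self sum_subtractf)
qed

lemma orthonormal_extend:
  fixes e :: "'i \<Rightarrow> 'k::finite \<Rightarrow> complex"
  assumes "finite I" "\<And>i j. i \<in> I \<Longrightarrow> j \<in> I \<Longrightarrow> cip (e i) (e j) = (if i = j then 1 else 0)"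
    and "card I < CARD('k)"
  shows "\<exists>v. (\<forall>i\<in>I. cip (e i) v = 0) \<and> v \<noteq> (\<lambda>_. 0)"
proof -
  define v where "v \<equiv> \<lambda>k q. (if q = k then 1 else 0) - (\<Sum>i\<in>I. cnj (e i k) * e i q)"
  have b: "cip (e i) (v k) = 0" if "i \<in> I" for i k
    unfolding v_def by (rule bessel_count(1)[OF assms(1,2) that])
  have b': "(\<Sum>k\<in>UNIV. cip (v k) (v k)) = of_nat CARD('k) - of_nat (card I)"
    unfolding v_def by (rule bessel_count(2)[OF assms(1,2)])
  have "\<exists>k q. v k q \<noteq> 0"
  proof (rule ccontr)
    assume "\<not> ?thesis"
    then have "v = (\<lambda>_ _. 0)" by (simp add: fun_eq_iff)
    then have "of_nat CARD('k) - of_nat (card I) = (0::complex)"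
      using b' by (simp add: cip_def)
    then show False using assms(3) by simp
  qed
  then obtain k q where "v k q \<noteq> 0" by blast
  then have "v k \<noteq> (\<lambda>_. 0)" by (auto simp: fun_eq_iff)
  then show ?thesis using b by blast
qed

lemma orthonormal_complete:
  fixes e :: "'k \<Rightarrow> 'k::finite \<Rightarrow> complex"
  assumes "\<And>i j. cip (e i) (e j) = (if i = j then 1 else 0)"
  shows "(\<Sum>i\<in>UNIV. e i q * cnj (e i k)) = (if q = k then 1 else 0)"
proof -
  define v where "v \<equiv> \<lambda>k q. (if q = k then 1 else 0) - (\<Sum>i\<in>UNIV. cnj (e i k) * e i q)"
  have "(\<Sum>k\<in>UNIV. cip (v k) (v k)) = 0"
    using bessel_count(2)[of UNIV e] assms by (simp add: v_def)
  then have "(\<Sum>k\<in>UNIV. Re (cip (v k) (v k))) = 0"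
    by (metis Re_sum zero_complex.simps(1))
  then have "Re (cip (v k) (v k)) = 0"
    by (subst (asm) sum_nonneg_eq_0_iff) (auto simp: cip_self sum_nonneg)
  then have "v k q = 0" by (rule cip_self_eq_0)
  then show ?thesis by (simp add: v_def mult.commute)
qed

text \<open>The Rayleigh quotient of \<open>K\<close> attains its maximum over the unit vectors orthogonal to the
  eigenvectors already found, and a maximiser is an eigenvector.\<close>
lemma rayleigh_eigenvector:
  fixes e :: "'i \<Rightarrow> 'k::finite \<Rightarrow> complex"
  assumes K: "hermitian K"
    and ev: "\<And>i. i \<in> I \<Longrightarrow> app K (e i) = (\<lambda>q. complex_of_real (l i) * e i q)"
    and v0: "\<And>i. i \<in> I \<Longrightarrow> cip (e i) v0 = 0" "v0 \<noteq> (\<lambda>_. 0)"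
  shows "\<exists>v m. (\<forall>i\<in>I. cip (e i) v = 0) \<and> cip v v = 1 \<and> app K v = (\<lambda>q. complex_of_real m * v q)"
proof -
  define N where "N u = Re (cip u u)" for u :: "'k \<Rightarrow> complex"
  define Q where "Q u = Re (cip u (app K u))" for u
  define V where "V = {u. \<forall>i\<in>I. cip (e i) u = 0}"
  \<comment> \<open>The constraint set is carried over to \<open>complex^'k\<close>, where closed
    and bounded sets are compact.\<close>
  define S where "S = {u :: complex^'k. norm u = 1 \<and> vec_nth u \<in> V}"
  have N_nn: "0 \<le> N u" for u by (simp add: N_def cip_self sum_nonneg)
  have Nc: "cip u u = of_real (N u)" for u by (simp add: N_def cip_self)
  have norm_N: "norm u = sqrt (N (vec_nth u))" for u :: "complex^'k"
    by (simp add: norm_vec_def L2_set_def N_def cip_self sum_nonneg)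
  have scaleN: "N (\<lambda>k. of_real c * u k) = c\<^sup>2 * N u" for c u
    by (simp add: N_def cip_scale_left cip_scale_right power2_eq_square)
  have scaleQ: "Q (\<lambda>k. of_real c * u k) = c\<^sup>2 * Q u" for c u
    by (simp add: Q_def app_scale cip_scale_left cip_scale_right power2_eq_square)
  have scaleV: "(\<lambda>k. c * u k) \<in> V" if "u \<in> V" for c u
    using that by (simp add: V_def cip_scale_right)
  have N0: "N v0 > 0"
    using v0(2) N_nn[of v0] cip_self_eq_0[of v0] by (auto simp: N_def fun_eq_iff less_le)
  have unit: "N (\<lambda>k. of_real (1 / sqrt (N u)) * u k) = 1" if "N u > 0" for u
    unfolding scaleN using that by (simp add: power_divide)
  have "closed S"
  proof -
    have "closed {u :: complex^'k. norm u = 1}"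
      by (intro closed_Collect_eq continuous_intros)
    moreover have "closed {u :: complex^'k. cip (e i) (vec_nth u) = 0}" for i
      unfolding cip_def by (intro closed_Collect_eq continuous_intros)
    then have "closed (\<Inter>i\<in>I. {u :: complex^'k. cip (e i) (vec_nth u) = 0})" by blast
    moreover have "S = {u. norm u = 1} \<inter> (\<Inter>i\<in>I. {u. cip (e i) (vec_nth u) = 0})"
      by (auto simp: S_def V_def)
    ultimately show ?thesis by auto
  qed
  moreover have "bounded S" by (auto simp: bounded_iff S_def intro!: exI[of _ 1])
  ultimately have cpt: "compact S" by (simp add: compact_eq_bounded_closed)
  have ne: "S \<noteq> {}"
  proof -
    define u where "u = (\<lambda>k. of_real (1 / sqrt (N v0)) * v0 k)"
    have "N u = 1" using unit[OF N0] by (simp add: u_def)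
    moreover have "u \<in> V" unfolding u_def by (rule scaleV) (use v0 in \<open>auto simp: V_def\<close>)
    moreover have "norm (vec_lambda u) = 1"
      using \<open>N u = 1\<close> by (simp add: norm_N vec_lambda_inverse)
    ultimately have "vec_lambda u \<in> S" by (simp add: S_def vec_lambda_inverse)
    then show ?thesis by auto
  qed
  have cont: "continuous_on S (\<lambda>u. Q (vec_nth u))"
    unfolding Q_def cip_def app_def by (intro continuous_intros)
  from continuous_attains_sup[OF cpt ne cont]
  obtain s where s: "s \<in> S" "\<forall>u\<in>S. Q (vec_nth u) \<le> Q (vec_nth s)" by (elim bexE)
  define v where "v = vec_nth s"
  define m where "m = Q v"
  have vV: "v \<in> V" and Nv: "N v = 1"
    using s(1) norm_N[of s] by (auto simp: v_def S_def)
  \<comment> \<open>By homogeneity the bound passes from unit vectors to all of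
    \<open>V\<close>.\<close>
  have max: "Q u \<le> m * N u" if u: "u \<in> V" for u
  proof (cases "N u = 0")
    case True
    then have "u = (\<lambda>_. 0)" using cip_self_eq_0[of u] by (auto simp: N_def)
    then show ?thesis using True by (simp add: Q_def cip_def)
  next
    case False
    then have pos: "N u > 0" using N_nn[of u] by simp
    define w where "w = (\<lambda>k. of_real (1 / sqrt (N u)) * u k)"
    have "N w = 1" using unit[OF pos] by (simp add: w_def)
    moreover have "w \<in> V" unfolding w_def by (rule scaleV[OF u])
    moreover have "norm (vec_lambda w) = 1"
      using \<open>N w = 1\<close> by (simp add: norm_N vec_lambda_inverse)
    ultimately have "vec_lambda w \<in> S" by (simp add: S_def vec_lambda_inverse)
    with s(2) have "Q (vec_nth (vec_lambda w)) \<le> Q (vec_nth s)" by (rule bspec)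
    then have "Q w \<le> m" by (simp add: m_def v_def vec_lambda_inverse)
    moreover have "Q w = Q u / N u" unfolding w_def scaleQ using pos by (simp add: power_divide)
    ultimately show ?thesis using pos by (simp add: field_simps)
  qed
  \<comment> \<open>\<open>w\<close> is the residual of the eigenvalue equation. It lies in
    \<open>V\<close>, which \<open>K\<close> leaves invariant, and it is orthogonal to
    \<open>v\<close>, so moving \<open>v\<close> towards \<open>w\<close> is an admissible
    variation.\<close>
  define w where "w = (\<lambda>q. app K v q - of_real m * v q)"
  have Qc: "cip v (app K v) = of_real m"
  proof -
    have "cip v (app K v) = cnj (cip v (app K v))"
      using hermitian_cip[OF K, of v v] cip_commute[of v "app K v"] by simp
    then show ?thesis by (simp add: m_def Q_def complex_eq_iff)
  qed
  have wV: "w \<in> V"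
  proof -
    have "cip (e i) w = 0" if "i \<in> I" for i
    proof -
      have "cip (e i) v = 0" using vV that by (simp add: V_def)
      then show ?thesis
        unfolding w_def cip_diff_right cip_scale_right hermitian_cip[OF K] ev[OF that] cip_scale_left
        by simp
    qed
    then show ?thesis by (simp add: V_def)
  qed
  have wv: "cip v w = 0"
    unfolding w_def cip_diff_right cip_scale_right using Qc Nc[of v] Nv by simp
  then have wv': "cip w v = 0" using cip_commute[of w v] by simp
  have app_v: "app K v = (\<lambda>q. w q + of_real m * v q)" by (simp add: w_def)
  have wKv: "cip w (app K v) = of_real (N w)"
    unfolding app_v cip_add_right cip_scale_right wv' using Nc[of w] by simp
  have vKw: "cip v (app K w) = of_real (N w)"
    unfolding hermitian_cip[OF K] app_v cip_add_left cip_scale_left wv using Nc[of w] by simp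
  \<comment> \<open>Along \<open>v + t w\<close> the form \<open>Q\<close> gains
    \<open>2 t N w\<close> to first order, while the bound \<open>m N\<close> moves only by a
    multiple of the square of \<open>t\<close>; small \<open>t\<close> therefore forces
    \<open>N w = 0\<close>.\<close>
  have le: "2 * N w \<le> t * (m * N w - Q w)" if "t > 0" for t
  proof -
    let ?u = "\<lambda>k. v k + of_real t * w k"
    have "?u \<in> V" using vV wV by (simp add: V_def cip_add_right cip_scale_right)
    then have "Q ?u \<le> m * N ?u" by (rule max)
    moreover have "N ?u = 1 + t\<^sup>2 * N w"
      using wv wv' Nv unfolding N_def
      by (simp add: cip_add_left cip_add_right cip_scale_left cip_scale_right power2_eq_square)
    moreover have "Q ?u = m + 2 * t * N w + t\<^sup>2 * Q w"
      unfolding Q_def app_linear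
      by (simp add: cip_add_left cip_add_right cip_scale_left cip_scale_right power2_eq_square
          wKv vKw Qc algebra_simps)
    ultimately have "t * (2 * N w) \<le> t * (t * (m * N w - Q w))"
      by (simp add: algebra_simps power2_eq_square)
    then show ?thesis using that by (simp only: mult_le_cancel_left_pos)
  qed
  have "N w = 0"
  proof (rule ccontr)
    assume "N w \<noteq> 0"
    then have p: "N w > 0" using N_nn[of w] by simp
    \<comment> \<open>The summand \<open>1\<close> keeps \<open>C\<close> positive; with
      \<open>t = N w / C\<close> the estimate \<open>le\<close> shrinks to
      \<open>2 * N w \<le> N w\<close>.\<close>
    define C where "C = \<bar>m * N w - Q w\<bar> + 1"
    have C: "C > 0" "m * N w - Q w \<le> C" by (auto simp: C_def)
    have "2 * N w \<le> N w / C * (m * N w - Q w)" using p C by (intro le) simp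
    also have "\<dots> \<le> N w / C * C" using p C by (intro mult_left_mono) auto
    finally show False using p C by simp
  qed
  then have "w = (\<lambda>_. 0)" using cip_self_eq_0[of w] by (auto simp: N_def)
  then have "app K v = (\<lambda>q. of_real m * v q)" using app_v by simp
  moreover have "\<forall>i\<in>I. cip (e i) v = 0" using vV by (simp add: V_def)
  moreover have "cip v v = 1" using Nv Nc[of v] by simp
  ultimately show ?thesis by blast
qed

section \<open>Spectral decomposition and the entropy as a sum over eigenvalues\<close>

definition spectral :: "('k::finite \<Rightarrow> 'k \<Rightarrow> complex) \<Rightarrow> ('k \<Rightarrow> 'k \<Rightarrow> complex) \<Rightarrow> ('k \<Rightarrow> real) \<Rightarrow> bool" where
  "spectral K e l \<longleftrightarrow> (\<forall>i j. cip (e i) (e j) = (if i = j then 1 else 0)) \<and>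
     (\<forall>q q'. K q q' = (\<Sum>i\<in>UNIV. of_real (l i) * e i q * cnj (e i q')))"

text \<open>Induction on the set of indices that already carry eigenvectors: before the last step
  there is room for one more, which \<open>rayleigh_eigenvector\<close> supplies. At
  \<open>UNIV\<close>, completeness turns the eigenvalue equations into the expansion of
  \<open>K\<close>.\<close>

lemma spectral_exists:
  fixes K :: "'k::finite \<Rightarrow> 'k \<Rightarrow> complex"
  assumes K: "hermitian K"
  shows "\<exists>e l. spectral K e l"
proof -
  have "\<exists>e l. (\<forall>i\<in>I. \<forall>j\<in>I. cip (e i) (e j) = (if i = j then 1 else 0)) \<and>
      (\<forall>i\<in>I. app K (e i) = (\<lambda>q. complex_of_real (l i) * e i q))" for I :: "'k set"
  proof (induction I rule: finite_induct[OF finite])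
    case 1
    then show ?case by simp
  next
    case (2 a I)
    from 2(3) obtain e l where
      el: "(\<forall>i\<in>I. \<forall>j\<in>I. cip (e i) (e j) = (if i = j then 1 else 0)) \<and>
        (\<forall>i\<in>I. app K (e i) = (\<lambda>q. complex_of_real (l i) * e i q))" by (elim exE)
    note on = el[THEN conjunct1, rule_format] and ev = el[THEN conjunct2, rule_format]
    have lt: "card I < CARD('k)" using 2(2) by (intro psubset_card_mono) auto
    obtain v0 where v0: "\<forall>i\<in>I. cip (e i) v0 = 0" and ne: "v0 \<noteq> (\<lambda>_. 0)"
    proof -
      have "\<exists>v. (\<forall>i\<in>I. cip (e i) v = 0) \<and> v \<noteq> (\<lambda>_. 0)"
        by (rule orthonormal_extend[OF 2(1) _ lt]) (rule on)
      then show ?thesis using that by (elim exE conjE)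
    qed
    obtain v m where v: "\<forall>i\<in>I. cip (e i) v = 0" "cip v v = 1"
      "app K v = (\<lambda>q. complex_of_real m * v q)"
    proof -
      have "\<exists>v m. (\<forall>i\<in>I. cip (e i) v = 0) \<and> cip v v = 1 \<and> app K v = (\<lambda>q. complex_of_real m * v q)"
        by (rule rayleigh_eigenvector[OF K _ _ ne]) (use ev v0 in auto)
      then show ?thesis using that by (elim exE conjE)
    qed
    have v': "cip v (e i) = 0" if "i \<in> I" for i
      using v(1)[rule_format, OF that] cip_commute[of v "e i"] by simp
    show ?case
    proof (intro exI conjI ballI)
      fix i j assume "i \<in> insert a I" "j \<in> insert a I"
      then show "cip ((e(a := v)) i) ((e(a := v)) j) = (if i = j then 1 else 0)"
        using 2(2) on[of i j] v(1)[rule_format, of i] v'[of j] v(2) by (auto split: if_splits)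
    next
      fix i assume "i \<in> insert a I"
      then show "app K ((e(a := v)) i) = (\<lambda>q. complex_of_real ((l(a := m)) i) * (e(a := v)) i q)"
        using 2(2) ev[of i] v(3) by (auto split: if_splits)
    qed
  qed
  from this[of UNIV] obtain e l where el: "(\<forall>i\<in>UNIV :: 'k set. \<forall>j\<in>UNIV. cip (e i) (e j) = (if i = j then 1 else 0)) \<and>
      (\<forall>i\<in>UNIV. app K (e i) = (\<lambda>q. complex_of_real (l i) * e i q))" by (elim exE)
  have on: "cip (e i) (e j) = (if i = j then 1 else 0)" for i j
    by (rule el[THEN conjunct1, rule_format]) simp_all
  have ev: "app K (e i) = (\<lambda>q. complex_of_real (l i) * e i q)" for i
    by (rule el[THEN conjunct2, rule_format]) simp
  have "K q q' = (\<Sum>i\<in>UNIV. of_real (l i) * e i q * cnj (e i q'))" for q q'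
  proof -
    have "(\<Sum>i\<in>UNIV. of_real (l i) * e i q * cnj (e i q')) = (\<Sum>i\<in>UNIV. app K (e i) q * cnj (e i q'))"
      by (simp add: ev)
    also have "\<dots> = (\<Sum>r\<in>UNIV. K q r * (\<Sum>i\<in>UNIV. e i r * cnj (e i q')))"
      unfolding app_def sum_distrib_right sum_distrib_left by (subst sum.swap) (simp add: mult.assoc)
    also have "\<dots> = K q q'"
      unfolding orthonormal_complete[OF on] by (simp add: if_distrib cong: if_cong)
    finally show ?thesis ..
  qed
  then have "spectral K e l" unfolding spectral_def using on by simp
  then show ?thesis by (intro exI)
qed

text \<open>Root multiplicities become counts of indices, so that a sum over distinct roots can be
  read as a sum over an eigenbasis. Nonvanishing of the product is carried along because
  \<open>order_mult\<close> asks for it.\<close>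

lemma order_prod_linear:
  fixes l :: "'k::finite \<Rightarrow> complex"
  assumes "finite I"
  shows "(\<Prod>i\<in>I. [:- l i, 1:]) \<noteq> 0 \<and> order z (\<Prod>i\<in>I. [:- l i, 1:]) = card {i \<in> I. l i = z}"
  using assms
proof (induction I rule: finite_induct)
  case empty
  then show ?case by simp
next
  case (insert a I)
  have ord: "order z [:- l a, 1:] = (if l a = z then 1 else 0)"
  proof (cases "l a = z")
    case True
    then show ?thesis using order_power_n_n[of "l a" 1] by simp
  next
    case False
    then show ?thesis by (simp add: order_0I)
  qed
  have ne: "[:- l a, 1:] * (\<Prod>i\<in>I. [:- l i, 1:]) \<noteq> 0" using insert by (simp del: mult_pCons_left mult_pCons_right)
  have "{i \<in> insert a I. l i = z} = (if l a = z then insert a {i \<in> I. l i = z} else {i \<in> I. l i = z})"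
    by auto
  then have "card {i \<in> insert a I. l i = z} = order z [:- l a, 1:] + card {i \<in> I. l i = z}"
    using insert(1,2) by (simp add: ord)
  then show ?case
    unfolding prod.insert[OF insert(1,2)] order_mult[OF ne] using ne insert(3) by simp
qed

text \<open>With the eigenvectors as columns of \<open>U\<close>, the characteristic matrix factors
  as \<open>U ** D ** U'\<close>, where \<open>D\<close> is diagonal with linear entries.
  Completeness gives \<open>U ** U' = mat 1\<close>, so the outer determinants cancel.\<close>

lemma qcharpoly_spectral:
  fixes K :: "'k::finite \<Rightarrow> 'k \<Rightarrow> complex"
  assumes "spectral K e l"
  shows "qcharpoly K = (\<Prod>i\<in>UNIV. [:- complex_of_real (l i), 1:])"
proof -
  have on: "\<And>i j. cip (e i) (e j) = (if i = j then 1 else 0)"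
    and K: "\<And>q q'. K q q' = (\<Sum>i\<in>UNIV. of_real (l i) * e i q * cnj (e i q'))"
    using assms by (auto simp: spectral_def)
  note comp = orthonormal_complete[OF on]
  have comp': "(\<Sum>i\<in>UNIV. cnj (e i k) * e i q) = (if q = k then 1 else 0)" for q k
    using comp[of q k] by (simp add: mult.commute)
  define U :: "complex poly^'k^'k" where "U = (\<chi> q i. [:e i q:])"
  define U' :: "complex poly^'k^'k" where "U' = (\<chi> i q. [:cnj (e i q):])"
  define D :: "complex poly^'k^'k" where "D = (\<chi> i j. if i = j then [:- of_real (l i), 1:] else 0)"
  have pc: "(\<Sum>i\<in>A. [:f i:]) = [:\<Sum>i\<in>A. f i:]" if "finite A" for A and f :: "'k \<Rightarrow> complex"
    using that by (induction A rule: finite_induct) auto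
  have UU: "U ** U' = mat 1"
    by (simp add: U_def U'_def matrix_matrix_mult_def mat_def vec_eq_iff pc comp' pCons_one
        del: mult_pCons_left mult_pCons_right) (auto simp: comp pc mult.commute)
  have "(U ** D) ** U' = (\<chi> i j. (if i = j then [:0, 1:] else 0) - [:K i j:])"
  proof -
    have "((U ** D) ** U') $ q $ q' = (if q = q' then [:0, 1:] else 0) - [:K q q':]" for q q'
    proof -
      have "((U ** D) ** U') $ q $ q' = (\<Sum>i\<in>UNIV. [:e i q:] * [:- of_real (l i), 1:] * [:cnj (e i q'):])"
        by (simp add: U_def U'_def D_def matrix_matrix_mult_def if_distrib cong: if_cong)
      also have "\<dots> = (\<Sum>i\<in>UNIV. [:0,1:] * [:e i q * cnj (e i q'):] - [:of_real (l i) * e i q * cnj (e i q'):])"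
        by (rule sum.cong) (auto simp: algebra_simps)
      also have "\<dots> = [:0,1:] * [:\<Sum>i\<in>UNIV. e i q * cnj (e i q'):] - [:K q q':]"
        by (simp only: sum_subtractf sum_distrib_left[symmetric] pc[OF finite] K)
      finally show ?thesis by (simp add: comp)
    qed
    then show ?thesis by (simp add: vec_eq_iff)
  qed
  then have "qcharpoly K = det U * det D * det U'"
    unfolding qcharpoly_def by (metis det_mul)
  also have "\<dots> = det D * (det U * det U')" by (simp add: mult_ac)
  also have "det U * det U' = 1" by (metis UU det_mul det_I)
  also have "det D = (\<Prod>i\<in>UNIV. D $ i $ i)"
    by (rule det_diagonal) (simp add: D_def)
  finally show ?thesis by (simp add: D_def)
qed

text \<open>Indices are grouped by eigenvalue: a root \<open>z\<close> of order \<open>n\<close>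
  stands for \<open>n\<close> indices, each contributing \<open>eta (Re z)\<close>.\<close>

lemma vn_entropy_spectral:
  fixes K :: "'k::finite \<Rightarrow> 'k \<Rightarrow> complex"
  assumes "spectral K e l"
  shows "vn_entropy K = - (\<Sum>i\<in>UNIV. eta (l i))"
proof -
  let ?p = "\<Prod>i\<in>UNIV. [:- complex_of_real (l i), 1:]"
  have ord: "order z ?p = card {i. complex_of_real (l i) = z}" for z
    using order_prod_linear[of UNIV "\<lambda>i. complex_of_real (l i)" z] by simp
  have roots: "{z. poly ?p z = 0} = range (\<lambda>i. complex_of_real (l i))"
    by (auto simp: poly_prod)
  have "(\<Sum>i\<in>UNIV. eta (l i)) = (\<Sum>z\<in>range (\<lambda>i. complex_of_real (l i)).
      \<Sum>i\<in>{i\<in>UNIV. complex_of_real (l i) = z}. eta (l i))"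
    by (rule sum.image_gen) simp
  also have "\<dots> = (\<Sum>z\<in>range (\<lambda>i. complex_of_real (l i)). real (order z ?p) * eta (Re z))"
    unfolding ord by (intro sum.cong refl) auto
  finally show ?thesis
    unfolding vn_entropy_def qcharpoly_spectral[OF assms] roots by simp
qed

section \<open>Equality in the Holevo bound for block measurements\<close>

lemma orthonormal_expand:
  fixes e :: "'k \<Rightarrow> 'k::finite \<Rightarrow> complex"
  assumes "\<And>i j. cip (e i) (e j) = (if i = j then 1 else 0)"
  shows "(\<Sum>i\<in>UNIV. cip (e i) v * e i q) = v q"
proof -
  have "(\<Sum>i\<in>UNIV. cip (e i) v * e i q) = (\<Sum>i\<in>UNIV. \<Sum>k\<in>UNIV. v k * (e i q * cnj (e i k)))"
    by (simp add: cip_def sum_distrib_left sum_distrib_right mult_ac)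
  also have "\<dots> = (\<Sum>k\<in>UNIV. v k * (\<Sum>i\<in>UNIV. e i q * cnj (e i k)))"
    by (subst sum.swap) (simp add: sum_distrib_left)
  finally show ?thesis by (simp add: orthonormal_complete[OF assms] if_distrib cong: if_cong)
qed

lemma parseval:
  fixes e :: "'k \<Rightarrow> 'k::finite \<Rightarrow> complex"
  assumes "\<And>i j. cip (e i) (e j) = (if i = j then 1 else 0)"
  shows "cip u v = (\<Sum>i\<in>UNIV. cip u (e i) * cip (e i) v)"
proof -
  have "cip u v = cip u (\<lambda>q. \<Sum>i\<in>UNIV. cip (e i) v * e i q)"
    by (simp add: orthonormal_expand[OF assms])
  also have "\<dots> = (\<Sum>i\<in>UNIV. cip u (e i) * cip (e i) v)"
    unfolding cip_sum_right cip_scale_right by (simp add: mult.commute)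
  finally show ?thesis .
qed

lemma parseval_norm:
  fixes e :: "'k \<Rightarrow> 'k::finite \<Rightarrow> complex"
  assumes "\<And>i j. cip (e i) (e j) = (if i = j then 1 else 0)"
  shows "(\<Sum>i\<in>UNIV. (cmod (cip (e i) v))\<^sup>2) = (\<Sum>k\<in>UNIV. (cmod (v k))\<^sup>2)"
proof -
  have "complex_of_real (\<Sum>k\<in>UNIV. (cmod (v k))\<^sup>2) = (\<Sum>i\<in>UNIV. cip v (e i) * cip (e i) v)"
    using parseval[OF assms, of v v] by (simp only: cip_self)
  also have "\<dots> = (\<Sum>i\<in>UNIV. complex_of_real ((cmod (cip (e i) v))\<^sup>2))"
    by (rule sum.cong[OF refl], subst complex_norm_square, subst cip_commute) (rule mult.commute)
  finally have "complex_of_real (\<Sum>k\<in>UNIV. (cmod (v k))\<^sup>2) = complex_of_real (\<Sum>i\<in>UNIV. (cmod (cip (e i) v))\<^sup>2)"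
    by (simp only: of_real_sum)
  then show ?thesis by (simp only: of_real_eq_iff)
qed

lemma spectralD:
  assumes "spectral K e l"
  shows "cip (e i) (e j) = (if i = j then 1 else 0)"
    and "K q q' = (\<Sum>i\<in>UNIV. of_real (l i) * e i q * cnj (e i q'))"
  using assms unfolding spectral_def by simp_all

lemma spectral_diagonal:
  assumes "spectral K e l"
  shows "Re (K q q) = (\<Sum>i\<in>UNIV. l i * (cmod (e i q))\<^sup>2)"
proof -
  have "K q q = (\<Sum>i\<in>UNIV. of_real (l i * (cmod (e i q))\<^sup>2))"
    unfolding spectralD(2)[OF assms, of q q]
    by (rule sum.cong[OF refl], subst of_real_mult, subst complex_norm_square) (rule mult.assoc)
  then show ?thesis by (simp only: of_real_sum[symmetric] Re_complex_of_real)
qed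

lemma spectral_quadratic_form:
  assumes "spectral K e l"
  shows "Re (cip v (app K v)) = (\<Sum>i\<in>UNIV. l i * (cmod (cip (e i) v))\<^sup>2)"
proof -
  have "app K v q = (\<Sum>i\<in>UNIV. (of_real (l i) * cip (e i) v) * e i q)" for q
  proof -
    have "app K v q = (\<Sum>q'\<in>UNIV. \<Sum>i\<in>UNIV. of_real (l i) * e i q * (cnj (e i q') * v q'))"
      by (simp add: app_def spectralD(2)[OF assms] sum_distrib_right mult.assoc)
    also have "\<dots> = (\<Sum>i\<in>UNIV. of_real (l i) * e i q * cip (e i) v)"
      by (subst sum.swap) (simp add: cip_def sum_distrib_left)
    finally show ?thesis by (simp add: mult_ac)
  qed
  then have "app K v = (\<lambda>q. \<Sum>i\<in>UNIV. (of_real (l i) * cip (e i) v) * e i q)" by (rule ext)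
  then have "cip v (app K v) = (\<Sum>i\<in>UNIV. of_real (l i) * cip (e i) v * cip v (e i))"
    by (simp only: cip_sum_right cip_scale_right)
  also have "\<dots> = (\<Sum>i\<in>UNIV. of_real (l i * (cmod (cip (e i) v))\<^sup>2))"
    by (rule sum.cong[OF refl], subst of_real_mult, subst complex_norm_square, subst (2) cip_commute)
      (rule mult.assoc)
  finally show ?thesis by (simp only: of_real_sum[symmetric] Re_complex_of_real)
qed

definition psd :: "('k::finite \<Rightarrow> 'k \<Rightarrow> complex) \<Rightarrow> bool" where
  "psd K \<longleftrightarrow> hermitian K \<and> (\<forall>v. 0 \<le> Re (cip v (app K v)))"

lemma psd_spectral:
  assumes "psd K"
  shows "\<exists>e l. spectral K e l \<and> (\<forall>i. 0 \<le> l i)"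
proof -
  have "hermitian K" and nn: "\<And>v. 0 \<le> Re (cip v (app K v))" using assms by (auto simp: psd_def)
  from spectral_exists[OF this(1)] obtain e l where s: "spectral K e l" by (elim exE)
  have "0 \<le> l i" for i
  proof -
    have "Re (cip (e i) (app K (e i))) = (\<Sum>j\<in>UNIV. if j = i then l j else 0)"
      unfolding spectral_quadratic_form[OF s]
      by (rule sum.cong) (simp_all add: spectralD(1)[OF s])
    then show ?thesis using nn[of "e i"] by simp
  qed
  then show ?thesis using s by (intro exI conjI allI)
qed

text \<open>The quadratic form at \<open>v\<close> is a sum over \<open>t\<close> of squared moduli.
  Partial traces of a pure state have this shape, with \<open>t\<close> running over the traced
  registers.\<close>

lemma psd_gram:
  fixes G :: "'k::finite \<Rightarrow> 't::finite \<Rightarrow> complex"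
  shows "psd (\<lambda>q q'. \<Sum>t\<in>UNIV. G q t * cnj (G q' t))"
proof -
  have "cip v (app (\<lambda>q q'. \<Sum>t\<in>UNIV. G q t * cnj (G q' t)) v) =
      (\<Sum>t\<in>UNIV. of_real ((cmod (\<Sum>q\<in>UNIV. cnj (v q) * G q t))\<^sup>2))" for v
  proof -
    have "cip v (app (\<lambda>q q'. \<Sum>t\<in>UNIV. G q t * cnj (G q' t)) v) =
      (\<Sum>q\<in>UNIV. \<Sum>q'\<in>UNIV. \<Sum>t\<in>UNIV. (cnj (v q) * G q t) * (v q' * cnj (G q' t)))"
      by (simp add: cip_def app_def sum_distrib_left sum_distrib_right mult_ac)
    also have "\<dots> = (\<Sum>q\<in>UNIV. \<Sum>t\<in>UNIV. \<Sum>q'\<in>UNIV. (cnj (v q) * G q t) * (v q' * cnj (G q' t)))"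
      by (intro sum.cong refl) (rule sum.swap)
    also have "\<dots> = (\<Sum>t\<in>UNIV. \<Sum>q\<in>UNIV. \<Sum>q'\<in>UNIV. (cnj (v q) * G q t) * (v q' * cnj (G q' t)))"
      by (rule sum.swap)
    also have "\<dots> = (\<Sum>t\<in>UNIV. (\<Sum>q\<in>UNIV. cnj (v q) * G q t) * cnj (\<Sum>q\<in>UNIV. cnj (v q) * G q t))"
      by (simp add: sum_product)
    finally show ?thesis by (simp only: complex_norm_square)
  qed
  then show ?thesis
    unfolding psd_def by (auto simp: hermitian_def sum_nonneg mult.commute)
qed

lemma psd_sum:
  fixes K :: "'l \<Rightarrow> 'k::finite \<Rightarrow> 'k \<Rightarrow> complex"
  assumes "\<And>l. psd (K l)"
  shows "psd (\<lambda>q q'. \<Sum>l\<in>L. K l q q')"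
proof -
  have app: "app (\<lambda>q q'. \<Sum>l\<in>L. K l q q') v = (\<lambda>q. \<Sum>l\<in>L. app (K l) v q)" for v
    unfolding app_def sum_distrib_right by (rule ext, rule sum.swap)
  have h: "K l q' q = cnj (K l q q')" for l q q'
    using assms[of l] unfolding psd_def hermitian_def by blast
  have "hermitian (\<lambda>q q'. \<Sum>l\<in>L. K l q q')"
    unfolding hermitian_def cnj_sum by (intro allI sum.cong refl h)
  moreover have "0 \<le> Re (cip v (app (\<lambda>q q'. \<Sum>l\<in>L. K l q q') v))" for v
    unfolding app cip_sum_right Re_sum
    by (rule sum_nonneg) (use assms in \<open>simp add: psd_def\<close>)
  ultimately show ?thesis by (simp add: psd_def)
qed

text \<open>The left-hand side measures how far the diagonal matrix \<open>w\<close> is from the optimum of the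
  variational problem. A vanishing denominator does no harm: by \<open>supp\<close> all terms with it vanish.\<close>
lemma complete_the_square:
  fixes K R :: "'q::finite \<Rightarrow> 'q \<Rightarrow> complex" and w :: "'q \<Rightarrow> real"
  assumes K: "spectral K e k" and R: "spectral R f r"
    and k: "\<And>i. 0 \<le> k i" and r: "\<And>j. 0 \<le> r j"
    and supp: "\<And>i j. r j = 0 \<Longrightarrow> k i * (cmod (cip (e i) (f j)))\<^sup>2 = 0"
    and s: "0 \<le> s"
  defines "u \<equiv> \<lambda>i j. cip (e i) (f j)"
    and "W \<equiv> \<lambda>i j. cip (e i) (\<lambda>q. of_real (w q) * f j q)"
  shows "(\<Sum>i\<in>UNIV. \<Sum>j\<in>UNIV. (s * k i + r j) * (cmod (W i j - of_real (k i / (s * k i + r j)) * u i j))\<^sup>2)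
    = (\<Sum>i\<in>UNIV. \<Sum>j\<in>UNIV. (cmod (u i j))\<^sup>2 * (k i)\<^sup>2 / (s * k i + r j))
      + (\<Sum>q\<in>UNIV. (s * Re (K q q) + Re (R q q)) * (w q)\<^sup>2 - 2 * Re (K q q) * w q)"
proof -
  note e = spectralD(1)[OF K] and f = spectralD(1)[OF R]
  \<comment> \<open>\<open>w\<close> is real, so the diagonal matrix can act on either side;
    Parseval is thus available over \<open>i\<close> as well as over \<open>j\<close>.\<close>
  have W': "W i j = cip (\<lambda>q. of_real (w q) * e i q) (f j)" for i j
    by (simp add: W_def cip_def mult_ac)
  have summand: "(s * k i + r j) * (cmod (W i j - of_real (k i / (s * k i + r j)) * u i j))\<^sup>2 =
      (cmod (u i j))\<^sup>2 * (k i)\<^sup>2 / (s * k i + r j) + s * (k i * (cmod (W i j))\<^sup>2)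
      + r j * (cmod (W i j))\<^sup>2 - 2 * (k i * Re (u i j * cnj (W i j)))" for i j
  proof (cases "s * k i + r j = 0")
    \<comment> \<open>A zero denominator makes \<open>s * k i\<close> and \<open>r j\<close> vanish,
      the quotient is \<open>0\<close> by the division convention, and \<open>supp\<close> removes
      the remaining cross term.\<close>
    case True
    then have "s * k i = 0" "r j = 0" using s k[of i] r[of j] by (smt (verit) mult_nonneg_nonneg)+
    moreover from supp[OF this(2), of i] have "k i * Re (u i j * cnj (W i j)) = 0"
      by (auto simp: u_def)
    moreover have "s * (k i * (cmod (W i j))\<^sup>2) = 0" using \<open>s * k i = 0\<close> by auto
    ultimately show ?thesis by (simp only: True) simp
  next
    case False
    have eq: "(cmod (x - of_real c * y))\<^sup>2 = (cmod x)\<^sup>2 - 2 * c * Re (y * cnj x) + c\<^sup>2 * (cmod y)\<^sup>2"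
      for x y c
      unfolding cmod_power2 by (simp add: power2_eq_square algebra_simps)
    show ?thesis unfolding eq using False
      by (simp add: divide_simps) (simp add: algebra_simps power2_eq_square)
  qed
  \<comment> \<open>Parseval sums out one eigenbasis, and the eigenvalues weighting the other
    reassemble diagonal entries of \<open>K\<close> and \<open>R\<close>; hence \<open>w\<close>
    meets only these entries.\<close>
  have W1: "(\<Sum>j\<in>UNIV. (cmod (W i j))\<^sup>2) = (\<Sum>q\<in>UNIV. (w q)\<^sup>2 * (cmod (e i q))\<^sup>2)" for i
  proof -
    have "(\<Sum>j\<in>UNIV. (cmod (W i j))\<^sup>2) = (\<Sum>j\<in>UNIV. (cmod (cip (f j) (\<lambda>q. of_real (w q) * e i q)))\<^sup>2)"
      by (rule sum.cong[OF refl], subst W', subst cip_commute) simp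
    then show ?thesis unfolding parseval_norm[OF f] by (simp add: norm_mult power_mult_distrib)
  qed
  have W2: "(\<Sum>i\<in>UNIV. (cmod (W i j))\<^sup>2) = (\<Sum>q\<in>UNIV. (w q)\<^sup>2 * (cmod (f j q))\<^sup>2)" for j
    unfolding W_def parseval_norm[OF e] by (simp add: norm_mult power_mult_distrib)
  have W3: "(\<Sum>j\<in>UNIV. Re (u i j * cnj (W i j))) = (\<Sum>q\<in>UNIV. w q * (cmod (e i q))\<^sup>2)" for i
  proof -
    have "(\<Sum>j\<in>UNIV. u i j * cnj (W i j)) = cip (e i) (\<lambda>q. of_real (w q) * e i q)"
      unfolding parseval[OF f, of "e i" "\<lambda>q. of_real (w q) * e i q"]
      by (intro sum.cong refl) (simp only: u_def W' cip_commute[of "f _"])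
    also have "\<dots> = (\<Sum>q\<in>UNIV. of_real (w q * (cmod (e i q))\<^sup>2))"
      unfolding cip_def
      by (rule sum.cong[OF refl], subst of_real_mult, subst complex_norm_square) (simp only: mult_ac)
    finally show ?thesis by (simp only: Re_sum[symmetric] of_real_sum[symmetric] Re_complex_of_real)
  qed
  have dK: "(\<Sum>i\<in>UNIV. k i * (\<Sum>q\<in>UNIV. h q * (cmod (e i q))\<^sup>2)) = (\<Sum>q\<in>UNIV. Re (K q q) * h q)"
    for h :: "'q \<Rightarrow> real"
    unfolding spectral_diagonal[OF K] sum_distrib_right sum_distrib_left
    by (subst sum.swap) (simp add: mult_ac)
  have dR: "(\<Sum>j\<in>UNIV. r j * (\<Sum>q\<in>UNIV. h q * (cmod (f j q))\<^sup>2)) = (\<Sum>q\<in>UNIV. Re (R q q) * h q)"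
    for h :: "'q \<Rightarrow> real"
    unfolding spectral_diagonal[OF R] sum_distrib_right sum_distrib_left
    by (subst sum.swap) (simp add: mult_ac)
  have s1: "(\<Sum>i\<in>UNIV. \<Sum>j\<in>UNIV. s * (k i * (cmod (W i j))\<^sup>2)) = s * (\<Sum>q\<in>UNIV. Re (K q q) * (w q)\<^sup>2)"
    by (simp only: sum_distrib_left[symmetric] W1 dK)
  have s2: "(\<Sum>i\<in>UNIV. \<Sum>j\<in>UNIV. r j * (cmod (W i j))\<^sup>2) = (\<Sum>q\<in>UNIV. Re (R q q) * (w q)\<^sup>2)"
    by (subst sum.swap) (simp only: sum_distrib_left[symmetric] W2 dR)
  have s3: "(\<Sum>i\<in>UNIV. \<Sum>j\<in>UNIV. 2 * (k i * Re (u i j * cnj (W i j)))) = 2 * (\<Sum>q\<in>UNIV. Re (K q q) * w q)"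
    by (simp only: sum_distrib_left[symmetric] W3 dK)
  show ?thesis
    unfolding summand sum.distrib sum_subtractf s1 s2 s3
    by (simp add: sum.distrib sum_subtractf sum_distrib_left algebra_simps)
qed

section \<open>Block sums and calculus for logarithmic weights\<close>

lemma sum_fibres:
  fixes \<beta> :: "'q::finite \<Rightarrow> 'c::finite" and a :: "'q \<Rightarrow> real"
  shows "(\<Sum>q\<in>UNIV. a q * h (\<beta> q)) = (\<Sum>c\<in>UNIV. (\<Sum>q | \<beta> q = c. a q) * h c)"
proof -
  have "(\<Sum>q\<in>UNIV. a q * h (\<beta> q)) = (\<Sum>c\<in>UNIV. \<Sum>q | q \<in> UNIV \<and> \<beta> q = c. a q * h (\<beta> q))"
    by (rule sum.group[symmetric]) auto
  also have "\<dots> = (\<Sum>c\<in>UNIV. (\<Sum>q | \<beta> q = c. a q) * h c)"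
    unfolding sum_distrib_right by (intro sum.cong) auto
  finally show ?thesis .
qed

text \<open>This plays the part of an integral of \<open>G\<close> over the half-line with value
  \<open>D\<close>: \<open>g\<close> increases from \<open>0\<close> to \<open>D\<close>, and a
  positive \<open>G 0\<close> would lift \<open>g\<close> strictly above \<open>0\<close> at once,
  leaving no room for \<open>D \<le> 0\<close>.\<close>

lemma nonneg_deriv_limit:
  fixes g G :: "real \<Rightarrow> real"
  assumes g0: "g 0 = 0" and d: "\<And>s. 0 \<le> s \<Longrightarrow> DERIV g s :> G s" and G: "\<And>s. 0 \<le> s \<Longrightarrow> 0 \<le> G s"
    and lim: "(g \<longlongrightarrow> D) at_top"
  shows "0 \<le> D" and "D \<le> 0 \<Longrightarrow> G 0 = 0"
proof -
  have mono: "g a \<le> g b" if "0 \<le> a" "a \<le> b" for a b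
    by (rule DERIV_nonneg_imp_nondecreasing[OF that(2)]) (use d G that(1) order_trans in blast)
  have le: "g s \<le> D" if "0 \<le> s" for s
    by (rule tendsto_lowerbound[OF lim]) (use mono that in \<open>auto simp: eventually_at_top_linorder\<close>)
  then show "0 \<le> D" using g0 by force
  assume "D \<le> 0"
  show "G 0 = 0"
  proof (rule ccontr)
    assume "G 0 \<noteq> 0"
    then have "0 < G 0" using G[of 0] by simp
    from DERIV_pos_inc_right[OF d[of 0] this] obtain t where
      "t > 0" "\<forall>h>0. h < t \<longrightarrow> g 0 < g (0 + h)" by auto
    then have "g 0 < g (t / 2)" by simp
    with le[of "t/2"] \<open>t > 0\<close> \<open>D \<le> 0\<close> g0 show False by simp
  qed
qed

text \<open>An antiderivative in \<open>s\<close> of one summand of the variational expression,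
  normalised to vanish at \<open>s = 0\<close>. If \<open>r = 0\<close>, the weight
  \<open>t * k\<close> is zero and the function is constant.\<close>

lemma DERIV_log_weight:
  fixes t k r s :: real
  assumes "0 \<le> k" "0 \<le> r" "0 \<le> s" "r = 0 \<Longrightarrow> k * t = 0"
  shows "DERIV (\<lambda>s. t * k * (ln (s * k + r) - ln r)) s :> t * k\<^sup>2 / (s * k + r)"
proof (cases "r = 0")
  case True
  then have "k = 0 \<or> t = 0" using assms(4) by simp
  then show ?thesis using True by (elim disjE) simp_all
next
  case False
  then have "s * k + r > 0" using assms by (simp add: add_nonneg_pos)
  then show ?thesis
    by (auto intro!: derivative_eq_intros simp: power2_eq_square)
qed

text \<open>Since \<open>ln (s * k + r) - ln s = ln (k + r / s)\<close>, removing the divergence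
  \<open>ln s\<close> leaves \<open>ln k\<close> in the limit; this is how the logarithms of the
  entropies arise.\<close>

lemma tendsto_log_weight:
  fixes t k r :: real
  assumes "0 \<le> k" "0 \<le> r" "r = 0 \<Longrightarrow> k * t = 0"
  shows "((\<lambda>s. t * k * (ln (s * k + r) - ln r - ln s)) \<longlongrightarrow> t * k * (ln k - ln r)) at_top"
proof (cases "k * t = 0")
  case True
  then have "t * k = 0" by auto
  then show ?thesis by (simp only: mult_zero_left tendsto_const)
next
  case False
  then have kr: "k > 0" "r > 0" using assms by (auto simp: less_le)
  have "((\<lambda>s. r / s) \<longlongrightarrow> 0) at_top"
    by (rule tendsto_divide_0[OF tendsto_const]) (simp add: filterlim_at_top_imp_at_infinity filterlim_ident)
  then have "((\<lambda>s. t * k * (ln (k + r / s) - ln r)) \<longlongrightarrow> t * k * (ln (k + 0) - ln r)) at_top"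
    using kr by (intro tendsto_intros) auto
  moreover have "eventually (\<lambda>s. t * k * (ln (k + r / s) - ln r) = t * k * (ln (s * k + r) - ln r - ln s)) at_top"
    using eventually_gt_at_top[of 0]
  proof eventually_elim
    case (elim s)
    have "k + r / s = (s * k + r) / s" using elim by (simp add: field_simps)
    moreover have "ln ((s * k + r) / s) = ln (s * k + r) - ln s"
    proof -
      have "s * k + r > 0" using elim kr by (simp add: add_pos_pos)
      then show ?thesis using elim by (simp add: ln_div)
    qed
    ultimately show ?case by simp
  qed
  ultimately show ?thesis by (simp add: tendsto_cong)
qed


text \<open>\<open>D\<close> is the relative entropy of \<open>K\<close> to \<open>R\<close> minus
  that of the block weights \<open>p\<close> to \<open>m\<close>. It is the limit of a difference
  \<open>g\<close> of logarithmic weights whose derivative \<open>G\<close> is the weighted sum of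
  squares from \<open>complete_the_square\<close>. If \<open>D \<le> 0\<close>, the squares vanish
  at \<open>s = 0\<close>, so \<open>K\<close> is \<open>R\<close> with its rows rescaled by
  \<open>p / m\<close>.\<close>

lemma label_divergence:
  fixes K R :: "'q::finite \<Rightarrow> 'q \<Rightarrow> complex" and \<beta> :: "'q \<Rightarrow> 'c::finite"
  assumes K: "spectral K e k" and R: "spectral R f r"
    and k: "\<And>i. 0 \<le> k i" and r: "\<And>j. 0 \<le> r j"
    and supp: "\<And>i j. r j = 0 \<Longrightarrow> k i * (cmod (cip (e i) (f j)))\<^sup>2 = 0"
  defines "p \<equiv> \<lambda>c. \<Sum>q | \<beta> q = c. Re (K q q)" and "m \<equiv> \<lambda>c. \<Sum>q | \<beta> q = c. Re (R q q)"
  assumes suppc: "\<And>c. m c = 0 \<Longrightarrow> p c = 0"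
  defines "D \<equiv> (\<Sum>i\<in>UNIV. \<Sum>j\<in>UNIV. (cmod (cip (e i) (f j)))\<^sup>2 * k i * (ln (k i) - ln (r j)))
      - (\<Sum>c\<in>UNIV. p c * (ln (p c) - ln (m c)))"
  shows "0 \<le> D" and "D \<le> 0 \<Longrightarrow> K q q' = of_real (p (\<beta> q) / m (\<beta> q)) * R q q'"
proof -
  note e = spectralD(1)[OF K] and f = spectralD(1)[OF R]
  define u where "u i j = (cmod (cip (e i) (f j)))\<^sup>2" for i j
  have dK: "0 \<le> Re (K q q)" for q
    unfolding spectral_diagonal[OF K] by (intro sum_nonneg mult_nonneg_nonneg k) simp
  have dR: "0 \<le> Re (R q q)" for q
    unfolding spectral_diagonal[OF R] by (intro sum_nonneg mult_nonneg_nonneg r) simp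
  have p: "0 \<le> p c" and m: "0 \<le> m c" for c
    unfolding p_def m_def by (intro sum_nonneg dK dR)+
  define g where "g s = (\<Sum>i\<in>UNIV. \<Sum>j\<in>UNIV. u i j * k i * (ln (s * k i + r j) - ln (r j)))
      - (\<Sum>c\<in>UNIV. 1 * p c * (ln (s * p c + m c) - ln (m c)))" for s
  define G where "G s = (\<Sum>i\<in>UNIV. \<Sum>j\<in>UNIV. u i j * (k i)\<^sup>2 / (s * k i + r j))
      - (\<Sum>c\<in>UNIV. 1 * (p c)\<^sup>2 / (s * p c + m c))" for s
  \<comment> \<open>For a diagonal matrix that is constant on blocks, the quadratic in
    \<open>complete_the_square\<close> becomes
    \<open>(s * p c + m c) * x\<^sup>2 - 2 * p c * x\<close> on block \<open>c\<close>;
    \<open>w s\<close> takes its minimiser.\<close>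
  define w where "w s q = p (\<beta> q) / (s * p (\<beta> q) + m (\<beta> q))" for s q
  define W where "W s i j = cip (e i) (\<lambda>q. of_real (w s q) * f j q)" for s i j
  have G_eq: "G s = (\<Sum>i\<in>UNIV. \<Sum>j\<in>UNIV. (s * k i + r j) *
      (cmod (W s i j - of_real (k i / (s * k i + r j)) * cip (e i) (f j)))\<^sup>2)" if "0 \<le> s" for s
  proof -
    have "(\<Sum>q\<in>UNIV. (s * Re (K q q) + Re (R q q)) * (w s q)\<^sup>2 - 2 * Re (K q q) * w s q)
      = s * (\<Sum>q\<in>UNIV. Re (K q q) * (w s q)\<^sup>2) + (\<Sum>q\<in>UNIV. Re (R q q) * (w s q)\<^sup>2)
        - 2 * (\<Sum>q\<in>UNIV. Re (K q q) * w s q)"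
      by (simp add: sum.distrib sum_subtractf sum_distrib_left algebra_simps)
    also have "\<dots> = s * (\<Sum>c\<in>UNIV. p c * (p c / (s * p c + m c))\<^sup>2) + (\<Sum>c\<in>UNIV. m c * (p c / (s * p c + m c))\<^sup>2)
        - 2 * (\<Sum>c\<in>UNIV. p c * (p c / (s * p c + m c)))"
      unfolding w_def p_def m_def
      sum_fibres[of "\<lambda>q. Re (K q q)" "\<lambda>c. (p c / (s * p c + m c))\<^sup>2" \<beta>, unfolded p_def m_def]
      sum_fibres[of "\<lambda>q. Re (R q q)" "\<lambda>c. (p c / (s * p c + m c))\<^sup>2" \<beta>, unfolded p_def m_def]
      sum_fibres[of "\<lambda>q. Re (K q q)" "\<lambda>c. p c / (s * p c + m c)" \<beta>, unfolded p_def m_def] ..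
    also have "\<dots> = (\<Sum>c\<in>UNIV. (s * p c + m c) * (p c / (s * p c + m c))\<^sup>2 - 2 * p c * (p c / (s * p c + m c)))"
      by (simp add: sum.distrib sum_subtractf sum_distrib_left algebra_simps)
    also have "\<dots> = (\<Sum>c\<in>UNIV. - ((p c)\<^sup>2 / (s * p c + m c)))"
    proof (rule sum.cong[OF refl])
      fix c
      show "(s * p c + m c) * (p c / (s * p c + m c))\<^sup>2 - 2 * p c * (p c / (s * p c + m c))
          = - ((p c)\<^sup>2 / (s * p c + m c))"
        \<comment> \<open>If the denominator is \<open>0\<close>, division by zero yields
          \<open>0\<close> on both sides.\<close>
        by (cases "s * p c + m c = 0") (simp_all add: power2_eq_square)
    qed
    finally have fib: "(\<Sum>q\<in>UNIV. (s * Re (K q q) + Re (R q q)) * (w s q)\<^sup>2 - 2 * Re (K q q) * w s q)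
      = - (\<Sum>c\<in>UNIV. (p c)\<^sup>2 / (s * p c + m c))" by (simp add: sum_negf)
    show ?thesis
      using complete_the_square[OF K R k r supp that, of "w s"] fib
      by (simp add: G_def u_def W_def)
  qed
  have G_nn: "0 \<le> G s" if "0 \<le> s" for s
    unfolding G_eq[OF that]
    by (intro sum_nonneg mult_nonneg_nonneg add_nonneg_nonneg that k r) simp
  \<comment> \<open>Both sides are the trace of \<open>K\<close>; their equality makes the two
    divergent multiples of \<open>ln s\<close> cancel below.\<close>
  have total: "(\<Sum>i\<in>UNIV. \<Sum>j\<in>UNIV. u i j * k i) = (\<Sum>c\<in>UNIV. p c)"
  proof -
    have "(\<Sum>j\<in>UNIV. u i j) = 1" for i
    proof -
      have "(\<Sum>j\<in>UNIV. u i j) = (\<Sum>j\<in>UNIV. (cmod (cip (f j) (e i)))\<^sup>2)"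
        unfolding u_def by (rule sum.cong[OF refl], subst cip_commute) simp
      also have "\<dots> = Re (cip (e i) (e i))"
        unfolding parseval_norm[OF f] cip_self by simp
      finally show ?thesis by (simp add: e)
    qed
    then have "(\<Sum>i\<in>UNIV. \<Sum>j\<in>UNIV. u i j * k i) = (\<Sum>i\<in>UNIV. k i)"
      by (simp add: sum_distrib_right[symmetric])
    also have "\<dots> = (\<Sum>i\<in>UNIV. k i * Re (cip (e i) (e i)))"
      by (simp add: e)
    also have "\<dots> = (\<Sum>i\<in>UNIV. \<Sum>q\<in>UNIV. k i * (cmod (e i q))\<^sup>2)"
      unfolding cip_self by (simp add: sum_distrib_left)
    also have "\<dots> = (\<Sum>q\<in>UNIV. Re (K q q) * 1)"
      unfolding spectral_diagonal[OF K] mult_1_right by (rule sum.swap)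
    also have "\<dots> = (\<Sum>c\<in>UNIV. p c)"
      unfolding sum_fibres[of "\<lambda>q. Re (K q q)" "\<lambda>_. 1" \<beta>] p_def by simp
    finally show ?thesis .
  qed
  have deriv: "DERIV g s :> G s" if "0 \<le> s" for s
    unfolding g_def G_def
    by (intro DERIV_diff DERIV_sum DERIV_log_weight k r p m that)
      (use supp suppc in \<open>auto simp: u_def\<close>)
  have "((\<lambda>s. (\<Sum>i\<in>UNIV. \<Sum>j\<in>UNIV. u i j * k i * (ln (s * k i + r j) - ln (r j) - ln s))
      - (\<Sum>c\<in>UNIV. 1 * p c * (ln (s * p c + m c) - ln (m c) - ln s))) \<longlongrightarrow>
      (\<Sum>i\<in>UNIV. \<Sum>j\<in>UNIV. u i j * k i * (ln (k i) - ln (r j))) - (\<Sum>c\<in>UNIV. 1 * p c * (ln (p c) - ln (m c)))) at_top"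
    by (intro tendsto_diff tendsto_sum tendsto_log_weight k r p m)
      (use supp suppc in \<open>auto simp: u_def\<close>)
  moreover have "(\<Sum>i\<in>UNIV. \<Sum>j\<in>UNIV. u i j * k i * (ln (s * k i + r j) - ln (r j) - ln s))
      - (\<Sum>c\<in>UNIV. 1 * p c * (ln (s * p c + m c) - ln (m c) - ln s)) = g s" for s
  proof -
    have "(\<Sum>i\<in>UNIV. \<Sum>j\<in>UNIV. u i j * k i * (ln (s * k i + r j) - ln (r j) - ln s))
      = (\<Sum>i\<in>UNIV. \<Sum>j\<in>UNIV. u i j * k i * (ln (s * k i + r j) - ln (r j))) - (\<Sum>i\<in>UNIV. \<Sum>j\<in>UNIV. u i j * k i) * ln s"
      by (simp add: sum_distrib_right sum_subtractf right_diff_distrib)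
    moreover have "(\<Sum>c\<in>UNIV. 1 * p c * (ln (s * p c + m c) - ln (m c) - ln s))
      = (\<Sum>c\<in>UNIV. 1 * p c * (ln (s * p c + m c) - ln (m c))) - (\<Sum>c\<in>UNIV. p c) * ln s"
      by (simp add: sum_distrib_right sum_subtractf right_diff_distrib)
    ultimately show ?thesis unfolding g_def total by simp
  qed
  ultimately have lim: "(g \<longlongrightarrow> D) at_top" by (simp add: D_def u_def)
  have g0: "g 0 = 0" by (simp add: g_def)
  show "0 \<le> D" by (rule nonneg_deriv_limit(1)[OF g0 deriv G_nn lim])
  assume "D \<le> 0"
  have "G 0 = 0" by (rule nonneg_deriv_limit(2)[OF g0 deriv G_nn lim \<open>D \<le> 0\<close>])
  then have z: "(\<Sum>i\<in>UNIV. \<Sum>j\<in>UNIV. r j * (cmod (W 0 i j - of_real (k i / r j) * cip (e i) (f j)))\<^sup>2) = 0"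
    unfolding G_eq[OF order_refl] by simp
  \<comment> \<open>Entrywise in the two eigenbases this reads \<open>diag w R = K\<close>. Where
    \<open>r j = 0\<close> the square carries no information and \<open>supp\<close> takes
    over.\<close>
  have opt: "of_real (r j) * W 0 i j = of_real (k i) * cip (e i) (f j)" for i j
  proof (cases "r j = 0")
    case True
    then show ?thesis using supp[of j i] by auto
  next
    case False
    have "(\<Sum>j\<in>UNIV. r j * (cmod (W 0 i j - of_real (k i / r j) * cip (e i) (f j)))\<^sup>2) = 0"
      using z by (subst (asm) sum_nonneg_eq_0_iff) (auto intro!: sum_nonneg simp: r)
    then have "r j * (cmod (W 0 i j - of_real (k i / r j) * cip (e i) (f j)))\<^sup>2 = 0"
      by (subst (asm) sum_nonneg_eq_0_iff) (auto simp: r)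
    then have "W 0 i j = of_real (k i / r j) * cip (e i) (f j)" using False by simp
    then show ?thesis using False by simp
  qed
  have f_exp: "(\<Sum>j\<in>UNIV. cip (e i) (f j) * cnj (f j q')) = cnj (e i q')" for i
  proof -
    have "(\<Sum>j\<in>UNIV. cip (e i) (f j) * cnj (f j q')) = cnj (\<Sum>j\<in>UNIV. cip (f j) (e i) * f j q')"
      unfolding cnj_sum
      by (rule sum.cong[OF refl], subst cip_commute) simp
    then show ?thesis by (simp only: orthonormal_expand[OF f])
  qed
  have "K q q' = (\<Sum>i\<in>UNIV. \<Sum>j\<in>UNIV. e i q * (of_real (k i) * cip (e i) (f j)) * cnj (f j q'))"
    unfolding spectralD(2)[OF K, of q q'] f_exp[symmetric]
    by (simp add: sum_distrib_left mult_ac)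
  also have "\<dots> = (\<Sum>j\<in>UNIV. \<Sum>i\<in>UNIV. (of_real (r j) * cnj (f j q')) * (W 0 i j * e i q))"
    unfolding opt[symmetric] by (subst sum.swap) (simp add: mult_ac)
  also have "\<dots> = (\<Sum>j\<in>UNIV. (of_real (r j) * cnj (f j q')) * (of_real (w 0 q) * f j q))"
    unfolding sum_distrib_left[symmetric] W_def orthonormal_expand[OF e] ..
  also have "\<dots> = of_real (w 0 q) * R q q'"
    unfolding spectralD(2)[OF R, of q q'] by (simp add: sum_distrib_left mult_ac)
  finally show "K q q' = of_real (p (\<beta> q) / m (\<beta> q)) * R q q'" by (simp add: w_def)
qed

text \<open>\<open>le\<close> says that the measured information about the label is no smaller than
  the unmeasured one, with the common entropy of the label left out. Up to a factor
  \<open>ln 2\<close>, its two sides differ by the sum over labels of the divergences of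
  \<open>label_divergence\<close>; these are nonnegative, so each is zero.\<close>

theorem holevo_equality:
  fixes K :: "'l::finite \<Rightarrow> 'q::finite \<Rightarrow> 'q \<Rightarrow> complex" and \<beta> :: "'q \<Rightarrow> 'c::finite"
  assumes psd: "\<And>l. psd (K l)"
  defines "R \<equiv> \<lambda>q q'. \<Sum>l\<in>UNIV. K l q q'" and "p \<equiv> \<lambda>l c. \<Sum>q | \<beta> q = c. Re (K l q q)"
  assumes le: "vn_entropy R - (\<Sum>l\<in>UNIV. vn_entropy (K l))
    \<le> (\<Sum>l\<in>UNIV. \<Sum>c\<in>UNIV. eta (p l c)) - (\<Sum>c\<in>UNIV. eta (\<Sum>l\<in>UNIV. p l c))"
  shows "K l q q' = of_real (p l (\<beta> q) / (\<Sum>l\<in>UNIV. p l (\<beta> q))) * R q q'"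
proof -
  have "\<forall>l. \<exists>ek. spectral (K l) (fst ek) (snd ek) \<and> (\<forall>i. 0 \<le> snd ek i)"
    using psd_spectral[OF psd] by (simp add: split_paired_Ex)
  from choice[OF this] obtain ek where
    ek: "\<forall>l. spectral (K l) (fst (ek l)) (snd (ek l)) \<and> (\<forall>i. 0 \<le> snd (ek l) i)" by (elim exE)
  define e where "e l = fst (ek l)" for l
  define k where "k l = snd (ek l)" for l
  have K: "spectral (K l) (e l) (k l)" and k: "0 \<le> k l i" for l i
    using ek by (simp_all add: e_def k_def)
  have "psd R" unfolding R_def by (rule psd_sum[OF psd])
  from psd_spectral[OF this] obtain f r where
    fr: "spectral R f r \<and> (\<forall>j. 0 \<le> r j)" by (elim exE)
  then have R: "spectral R f r" and r: "\<And>j. 0 \<le> r j" by simp_all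
  define u where "u l i j = (cmod (cip (e l i) (f j)))\<^sup>2" for l i j
  define m where "m c = (\<Sum>q | \<beta> q = c. Re (R q q))" for c
  have m_eq: "m c = (\<Sum>l\<in>UNIV. p l c)" for c
    unfolding m_def p_def R_def Re_sum by (rule sum.swap)
  \<comment> \<open>As \<open>R\<close> is the sum of the \<open>K l\<close>, each eigenvalue of
    \<open>R\<close> is a sum of nonnegative overlaps; a zero eigenvalue kills them all, which is
    the support condition for every label.\<close>
  have r_eq: "r j = (\<Sum>l\<in>UNIV. \<Sum>i\<in>UNIV. u l i j * k l i)" for j
  proof -
    have app: "app R v = (\<lambda>q. \<Sum>l\<in>UNIV. app (K l) v q)" for v
      unfolding app_def R_def sum_distrib_right by (rule ext, rule sum.swap)
    have "r j = Re (cip (f j) (app R (f j)))"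
    proof -
      have "r i * (cmod (cip (f i) (f j)))\<^sup>2 = (if i = j then r i else 0)" for i
        by (simp add: spectralD(1)[OF R])
      then show ?thesis unfolding spectral_quadratic_form[OF R] by simp
    qed
    also have "\<dots> = (\<Sum>l\<in>UNIV. \<Sum>i\<in>UNIV. u l i j * k l i)"
      unfolding app cip_sum_right Re_sum spectral_quadratic_form[OF K] by (simp add: u_def mult.commute)
    finally show ?thesis .
  qed
  have supp: "k l i * (cmod (cip (e l i) (f j)))\<^sup>2 = 0" if "r j = 0" for l i j
  proof -
    have nn: "0 \<le> u l i j * k l i" for l i using k by (simp add: u_def)
    have "(\<Sum>l\<in>UNIV. \<Sum>i\<in>UNIV. u l i j * k l i) = 0" using that r_eq by simp
    then have "(\<Sum>i\<in>UNIV. u l i j * k l i) = 0"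
      by (subst (asm) sum_nonneg_eq_0_iff) (auto intro!: sum_nonneg nn)
    then have "u l i j * k l i = 0"
      by (subst (asm) sum_nonneg_eq_0_iff) (auto intro!: nn)
    then show ?thesis by (auto simp: u_def)
  qed
  have p: "0 \<le> p l c" for l c
    unfolding p_def spectral_diagonal[OF K] by (intro sum_nonneg mult_nonneg_nonneg k) simp
  have suppc: "p l c = 0" if "m c = 0" for l c
    using that unfolding m_eq by (subst (asm) sum_nonneg_eq_0_iff) (auto simp: p)
  define D where "D l = (\<Sum>i\<in>UNIV. \<Sum>j\<in>UNIV. u l i j * k l i * (ln (k l i) - ln (r j)))
      - (\<Sum>c\<in>UNIV. p l c * (ln (p l c) - ln (m c)))" for l
  have D: "0 \<le> D l" for l
    unfolding D_def u_def m_def p_def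
    by (rule label_divergence(1)[OF K R k r supp]) (use suppc in \<open>simp_all add: m_def p_def\<close>)
  have eta: "eta t = t * ln t / ln 2" for t by (simp add: eta_def log_def)
  have "(\<Sum>l\<in>UNIV. D l) = (\<Sum>l\<in>UNIV. \<Sum>i\<in>UNIV. k l i * ln (k l i)) - (\<Sum>j\<in>UNIV. r j * ln (r j))
      - (\<Sum>l\<in>UNIV. \<Sum>c\<in>UNIV. p l c * ln (p l c)) + (\<Sum>c\<in>UNIV. m c * ln (m c))"
  proof -
    \<comment> \<open>Summed over \<open>j\<close> the overlaps give \<open>1\<close>, so
      \<open>ln (k l i)\<close> keeps its weight; summed over \<open>l\<close> and \<open>i\<close>
      the weighted overlaps give \<open>r j\<close>.\<close>
    have row: "(\<Sum>j\<in>UNIV. u l i j) = 1" for l i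
    proof -
      have "(\<Sum>j\<in>UNIV. u l i j) = (\<Sum>j\<in>UNIV. (cmod (cip (f j) (e l i)))\<^sup>2)"
        unfolding u_def by (rule sum.cong[OF refl], subst cip_commute) simp
      also have "\<dots> = Re (cip (e l i) (e l i))"
        unfolding parseval_norm[OF spectralD(1)[OF R]] cip_self by simp
      finally show ?thesis by (simp add: spectralD(1)[OF K])
    qed
    have "(\<Sum>l\<in>UNIV. \<Sum>i\<in>UNIV. \<Sum>j\<in>UNIV. u l i j * k l i * ln (r j))
        = (\<Sum>l\<in>UNIV. \<Sum>j\<in>UNIV. \<Sum>i\<in>UNIV. u l i j * k l i * ln (r j))"
      by (rule sum.cong[OF refl]) (rule sum.swap)
    also have "\<dots> = (\<Sum>j\<in>UNIV. \<Sum>l\<in>UNIV. \<Sum>i\<in>UNIV. u l i j * k l i * ln (r j))"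
      by (rule sum.swap)
    also have "\<dots> = (\<Sum>j\<in>UNIV. r j * ln (r j))"
      unfolding sum_distrib_right[symmetric] r_eq[symmetric] ..
    finally have 1: "(\<Sum>l\<in>UNIV. \<Sum>i\<in>UNIV. \<Sum>j\<in>UNIV. u l i j * k l i * ln (r j)) = (\<Sum>j\<in>UNIV. r j * ln (r j))" .
    have 2: "(\<Sum>l\<in>UNIV. \<Sum>i\<in>UNIV. \<Sum>j\<in>UNIV. u l i j * k l i * ln (k l i)) = (\<Sum>l\<in>UNIV. \<Sum>i\<in>UNIV. k l i * ln (k l i))"
      unfolding sum_distrib_right[symmetric] row by simp
    have "(\<Sum>l\<in>UNIV. \<Sum>c\<in>UNIV. p l c * ln (m c)) = (\<Sum>c\<in>UNIV. \<Sum>l\<in>UNIV. p l c * ln (m c))"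
      by (rule sum.swap)
    also have "\<dots> = (\<Sum>c\<in>UNIV. m c * ln (m c))"
      unfolding sum_distrib_right[symmetric] m_eq[symmetric] ..
    finally show ?thesis
      unfolding D_def right_diff_distrib sum_subtractf 1 2 by simp
  qed
  also have "\<dots> \<le> 0"
  proof -
    have "(\<Sum>l\<in>UNIV. \<Sum>i\<in>UNIV. k l i * ln (k l i)) / ln 2 - (\<Sum>j\<in>UNIV. r j * ln (r j)) / ln 2
      \<le> (\<Sum>l\<in>UNIV. \<Sum>c\<in>UNIV. p l c * ln (p l c)) / ln 2 - (\<Sum>c\<in>UNIV. m c * ln (m c)) / ln 2"
      using le unfolding vn_entropy_spectral[OF K] vn_entropy_spectral[OF R] m_eq[symmetric] eta
      by (simp add: sum_divide_distrib sum_negf)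
    then show ?thesis by (simp add: diff_divide_distrib[symmetric] divide_right_mono_neg divide_le_cancel)
  qed
  finally have "(\<Sum>l\<in>UNIV. D l) \<le> 0" .
  then have "(\<Sum>l\<in>UNIV. D l) = 0" using D by (simp add: sum_nonneg order_antisym)
  then have "D l = 0" by (subst (asm) sum_nonneg_eq_0_iff) (auto simp: D)
  then have "D l \<le> 0" by simp
  then have "K l q q' = of_real (p l (\<beta> q) / m (\<beta> q)) * R q q'"
    unfolding D_def u_def m_def p_def
    by (intro label_divergence(2)[OF K R k r supp]) (use suppc in \<open>simp_all add: m_def p_def\<close>)
  then show ?thesis by (simp only: m_eq)
qed

section \<open>Reduced states\<close>

lemma vn_entropy_diagonal:
  fixes d :: "'k::finite \<Rightarrow> real"
  shows "vn_entropy (\<lambda>i j. if i = j then complex_of_real (d i) else 0) = - (\<Sum>i\<in>UNIV. eta (d i))"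
proof (rule vn_entropy_spectral)
  show "spectral (\<lambda>i j. if i = j then complex_of_real (d i) else 0) (\<lambda>i j. if i = j then 1 else 0) d"
    unfolding spectral_def cip_def
    by (auto simp: if_distrib[of cnj] if_distrib[of "\<lambda>x. _ * x"] if_distrib[of "\<lambda>x. x * _"] cong: if_cong)
qed

text \<open>The eigenbases of the blocks, extended by zero, together form an eigenbasis.
  \<open>\<pi>\<close> lets the block label sit anywhere among the registers.\<close>

lemma vn_entropy_block_diagonal:
  fixes K :: "'l::finite \<Rightarrow> 'q::finite \<Rightarrow> 'q \<Rightarrow> complex" and \<pi> :: "'k::finite \<Rightarrow> 'l \<times> 'q"
  assumes \<pi>: "bij \<pi>" and K: "\<And>l. hermitian (K l)"
  shows "vn_entropy (\<lambda>k k'. if fst (\<pi> k) = fst (\<pi> k') then K (fst (\<pi> k)) (snd (\<pi> k)) (snd (\<pi> k')) else 0)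
    = (\<Sum>l\<in>UNIV. vn_entropy (K l))"
proof -
  have "\<forall>l. \<exists>ek. spectral (K l) (fst ek) (snd ek)"
    using spectral_exists[OF K] by (simp add: split_paired_Ex)
  from choice[OF this] obtain ek where ek: "\<forall>l. spectral (K l) (fst (ek l)) (snd (ek l))"
    by (elim exE)
  define e where "e l = fst (ek l)" for l
  define m where "m l = snd (ek l)" for l
  have sp: "spectral (K l) (e l) (m l)" for l
    using ek by (simp add: e_def m_def)
  define E where "E k0 k = (if fst (\<pi> k0) = fst (\<pi> k) then e (fst (\<pi> k0)) (snd (\<pi> k0)) (snd (\<pi> k)) else 0)" for k0 k
  define L where "L k = m (fst (\<pi> k)) (snd (\<pi> k))" for k
  have reindex: "(\<Sum>k\<in>UNIV. F (\<pi> k)) = (\<Sum>l\<in>UNIV. \<Sum>q\<in>UNIV. F (l, q))" for F :: "'l \<times> 'q \<Rightarrow> 'z::comm_monoid_add"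
    by (subst sum.reindex_bij_betw[OF \<pi>[unfolded bij_def[symmetric]]], simp add: sum.cartesian_product)
  have pi_eq: "i = j \<longleftrightarrow> fst (\<pi> i) = fst (\<pi> j) \<and> snd (\<pi> i) = snd (\<pi> j)" for i j
    using \<pi> by (metis bij_is_inj inj_eq prod_eq_iff)
  have pull: "(\<Sum>l\<in>UNIV. \<Sum>q\<in>UNIV. if a = l then F l q else 0) = (\<Sum>q\<in>UNIV. F a q)"
    for a and F :: "'l \<Rightarrow> 'q \<Rightarrow> complex"
  proof -
    have "(\<Sum>l\<in>UNIV. \<Sum>q\<in>UNIV. if a = l then F l q else 0) = (\<Sum>l\<in>UNIV. if a = l then (\<Sum>q\<in>UNIV. F l q) else 0)"
      by (rule sum.cong) auto
    then show ?thesis by simp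
  qed
  have on: "cip (E i) (E j) = (if i = j then 1 else 0)" for i j
  proof -
    have "cip (E i) (E j) = (\<Sum>l\<in>UNIV. \<Sum>q\<in>UNIV. if fst (\<pi> i) = l then
        (if fst (\<pi> j) = l then cnj (e l (snd (\<pi> i)) q) * e l (snd (\<pi> j)) q else 0) else 0)"
      unfolding cip_def E_def
      by (subst reindex[symmetric, of "\<lambda>lq. if fst (\<pi> i) = fst lq then
        (if fst (\<pi> j) = fst lq then cnj (e (fst lq) (snd (\<pi> i)) (snd lq)) * e (fst lq) (snd (\<pi> j)) (snd lq) else 0) else 0", unfolded fst_conv snd_conv])
        (rule sum.cong, auto)
    also have "\<dots> = (if fst (\<pi> i) = fst (\<pi> j) then cip (e (fst (\<pi> i)) (snd (\<pi> i))) (e (fst (\<pi> i)) (snd (\<pi> j))) else 0)"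
      unfolding pull cip_def by auto
    finally show ?thesis using spectralD(1)[OF sp] pi_eq[of i j] by simp
  qed
  have "(if fst (\<pi> k) = fst (\<pi> k') then K (fst (\<pi> k)) (snd (\<pi> k)) (snd (\<pi> k')) else 0)
      = (\<Sum>i\<in>UNIV. of_real (L i) * E i k * cnj (E i k'))" for k k'
  proof -
    have "(\<Sum>i\<in>UNIV. of_real (L i) * E i k * cnj (E i k')) =
      (\<Sum>l\<in>UNIV. \<Sum>q\<in>UNIV. if fst (\<pi> k) = l then
        (if l = fst (\<pi> k') then of_real (m l q) * e l q (snd (\<pi> k)) * cnj (e l q (snd (\<pi> k'))) else 0) else 0)"
      unfolding L_def E_def
      by (subst reindex[symmetric, of "\<lambda>lq. if fst (\<pi> k) = fst lq then
        (if fst lq = fst (\<pi> k') then of_real (m (fst lq) (snd lq)) * e (fst lq) (snd lq) (snd (\<pi> k)) * cnj (e (fst lq) (snd lq) (snd (\<pi> k'))) else 0) else 0", unfolded fst_conv snd_conv])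
        (rule sum.cong, auto)
    also have "\<dots> = (if fst (\<pi> k) = fst (\<pi> k') then K (fst (\<pi> k)) (snd (\<pi> k)) (snd (\<pi> k')) else 0)"
      unfolding pull spectralD(2)[OF sp] by auto
    finally show ?thesis by simp
  qed
  then have "spectral (\<lambda>k k'. if fst (\<pi> k) = fst (\<pi> k') then K (fst (\<pi> k)) (snd (\<pi> k)) (snd (\<pi> k')) else 0) E L"
    unfolding spectral_def using on by simp
  from vn_entropy_spectral[OF this] show ?thesis
    unfolding vn_entropy_spectral[OF sp] L_def
    using reindex[of "\<lambda>lq. eta (m (fst lq) (snd lq))"] by (simp add: sum_negf)
qed

text \<open>\<open>h\<close> inverts the splitting of an index into its kept part
  \<open>\<kappa>\<close> and traced part \<open>\<tau>\<close>; \<open>i\<close> and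
  \<open>j\<close> are determined by \<open>k\<close>, \<open>k'\<close> and one common
  \<open>t\<close>, which collapses the double sum.\<close>

lemma reduced_eq:
  fixes \<psi> :: "'i::finite \<Rightarrow> complex" and \<tau> :: "'i \<Rightarrow> 't::finite"
  assumes h: "\<And>i. h (\<kappa> i) (\<tau> i) = i" "\<And>k t. \<kappa> (h k t) = k" "\<And>k t. \<tau> (h k t) = t"
  shows "reduced \<psi> \<kappa> \<tau> \<delta> k k' =
    (\<Sum>t\<in>UNIV. if \<delta> (h k t) = \<delta> (h k' t) then \<psi> (h k t) * cnj (\<psi> (h k' t)) else 0)"
proof -
  have inner: "(\<Sum>j\<in>UNIV. if \<kappa> i = k \<and> \<kappa> j = k' \<and> \<tau> i = \<tau> j \<and> \<delta> i = \<delta> j then \<psi> i * cnj (\<psi> j) else 0)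
    = (if \<kappa> i = k then (if \<delta> i = \<delta> (h k' (\<tau> i)) then \<psi> i * cnj (\<psi> (h k' (\<tau> i))) else 0) else 0)" for i
  proof -
    have "(\<Sum>j\<in>UNIV. if \<kappa> i = k \<and> \<kappa> j = k' \<and> \<tau> i = \<tau> j \<and> \<delta> i = \<delta> j then \<psi> i * cnj (\<psi> j) else 0)
      = (\<Sum>j\<in>UNIV. if j = h k' (\<tau> i) then (if \<kappa> i = k \<and> \<delta> i = \<delta> j then \<psi> i * cnj (\<psi> j) else 0) else 0)"
    proof (rule sum.cong[OF refl])
      fix j
      have "\<kappa> j = k' \<and> \<tau> i = \<tau> j \<longleftrightarrow> j = h k' (\<tau> i)" using h by metis
      then show "(if \<kappa> i = k \<and> \<kappa> j = k' \<and> \<tau> i = \<tau> j \<and> \<delta> i = \<delta> j then \<psi> i * cnj (\<psi> j) else 0)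
        = (if j = h k' (\<tau> i) then (if \<kappa> i = k \<and> \<delta> i = \<delta> j then \<psi> i * cnj (\<psi> j) else 0) else 0)"
        by auto
    qed
    then show ?thesis by simp
  qed
  have range: "{i. \<kappa> i = k} = range (h k)"
    using h(2) by (auto simp: image_iff) (metis h(1))
  have inj: "inj (h k)" by (rule injI) (metis h(3))
  have "reduced \<psi> \<kappa> \<tau> \<delta> k k' =
    (\<Sum>i\<in>range (h k). if \<delta> i = \<delta> (h k' (\<tau> i)) then \<psi> i * cnj (\<psi> (h k' (\<tau> i))) else 0)"
    unfolding reduced_def inner range[symmetric] by (rule sum.mono_neutral_cong_right) auto
  also have "\<dots> = (\<Sum>t\<in>UNIV. if \<delta> (h k t) = \<delta> (h k' t) then \<psi> (h k t) * cnj (\<psi> (h k' t)) else 0)"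
    unfolding sum.reindex[OF inj] by (simp add: h(3) cong: if_cong)
  finally show ?thesis .
qed

section \<open>Shannon quantities\<close>

lemma shannon_H_eta: "shannon_H g P = - (\<Sum>v\<in>range g. eta (\<Sum>w | g w = v. P w))"
  by (simp add: shannon_H_def eta_def)

lemma fibre_fst: "(\<Sum>w | fst w = x. P w) = (\<Sum>y\<in>UNIV. P (x, y))"
  for P :: "'x::finite \<times> 'y::finite \<Rightarrow> 'z::comm_monoid_add"
proof -
  have "{w :: 'x \<times> 'y. fst w = x} = Pair x ` UNIV" by auto
  then show ?thesis by (simp add: sum.reindex inj_on_def)
qed

lemma fibre_snd: "(\<Sum>w | snd w = y. P w) = (\<Sum>x\<in>UNIV. P (x, y))"
  for P :: "'x::finite \<times> 'y::finite \<Rightarrow> 'z::comm_monoid_add"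
proof -
  have "{w :: 'x \<times> 'y. snd w = y} = (\<lambda>x. (x, y)) ` UNIV" by auto
  then show ?thesis by (simp add: sum.reindex inj_on_def)
qed

lemma sum_prod_UNIV: "(\<Sum>w\<in>UNIV. P w) = (\<Sum>x\<in>UNIV. \<Sum>y\<in>UNIV. P (x, y))"
  for P :: "'x::finite \<times> 'y::finite \<Rightarrow> 'z::comm_monoid_add"
  by (simp add: sum.cartesian_product)

lemma mutual_info_eta:
  fixes P :: "'x::finite \<times> 'y::finite \<Rightarrow> real"
  shows "mutual_info P = - (\<Sum>x\<in>UNIV. eta (\<Sum>y\<in>UNIV. P (x, y))) - (\<Sum>y\<in>UNIV. eta (\<Sum>x\<in>UNIV. P (x, y)))
    + (\<Sum>x\<in>UNIV. \<Sum>y\<in>UNIV. eta (P (x, y)))"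
proof -
  have "shannon_H id P = - (\<Sum>w\<in>UNIV. eta (P w))" by (simp add: shannon_H_eta)
  moreover have "shannon_H fst P = - (\<Sum>x\<in>UNIV. eta (\<Sum>y\<in>UNIV. P (x, y)))"
    by (simp add: shannon_H_eta fibre_fst)
  moreover have "shannon_H snd P = - (\<Sum>y\<in>UNIV. eta (\<Sum>x\<in>UNIV. P (x, y)))"
    by (simp add: shannon_H_eta fibre_snd)
  ultimately show ?thesis by (simp add: mutual_info_def sum_prod_UNIV)
qed

text \<open>For fixed \<open>y\<close> all \<open>x\<close> of positive probability share one
  conditional distribution, so a single value of the pair carries the whole mass of \<open>y\<close>
  and the two entropies agree term by term.\<close>

lemma trivial_primitiveI:
  fixes P :: "'x::finite \<times> 'y::finite \<Rightarrow> real"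
  assumes nn: "\<And>i. 0 \<le> P i"
    and dep: "\<And>x x' y. 0 < P (x, y) \<Longrightarrow> 0 < P (x', y) \<Longrightarrow> dep_fun P x = dep_fun P x'"
  shows "trivial_primitive P"
proof -
  let ?g = "\<lambda>(x, y). (dep_fun P x, y)"
  define S where "S v = (\<Sum>w | ?g w = v. P w)" for v
  have "(\<Sum>v\<in>range ?g. eta (S v)) = (\<Sum>y\<in>UNIV. \<Sum>v | v \<in> range ?g \<and> snd v = y. eta (S v))"
    by (rule sum.group[symmetric]) auto
  also have "\<dots> = (\<Sum>y\<in>UNIV. eta (\<Sum>w | snd w = y. P w))"
  proof (rule sum.cong[OF refl])
    fix y :: 'y
    have fin: "finite {v \<in> range ?g. snd v = y}" by simp
    show "(\<Sum>v | v \<in> range ?g \<and> snd v = y. eta (S v)) = eta (\<Sum>w | snd w = y. P w)"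
    proof (cases "\<exists>x0. 0 < P (x0, y)")
      case False
      then have z: "P (x, y) = 0" for x using nn[of "(x, y)"] by (meson not_le order_antisym)
      have "S v = 0" if "snd v = y" for v
        unfolding S_def using that z by (intro sum.neutral) auto
      then have "(\<Sum>v | v \<in> range ?g \<and> snd v = y. eta (S v)) = 0"
        by (intro sum.neutral) (auto simp: eta_def)
      moreover have "(\<Sum>w | snd w = y. P w) = 0" unfolding fibre_snd by (simp add: z)
      ultimately show ?thesis by (simp add: eta_def)
    next
      case True
      then obtain x0 where x0: "0 < P (x0, y)" by blast
      let ?v = "(dep_fun P x0, y)"
      have z: "P (x, y) = 0" if "dep_fun P x \<noteq> dep_fun P x0" for x
        using dep[OF x0, of x] that nn[of "(x, y)"] by (metis less_eq_real_def)
      have z': "dep_fun P x = dep_fun P x0" if "P (x, y) \<noteq> 0" for x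
        using that z by blast
      \<comment> \<open>Some \<open>x\<close> with \<open>P (x, y) = 0\<close> may produce further
        pairs, but these have mass \<open>0\<close>, and \<open>eta 0 = 0\<close>.\<close>
      have "S v = 0" if "snd v = y" "v \<noteq> ?v" for v
        unfolding S_def using that by (intro sum.neutral) (auto dest: z')
      moreover have "?v \<in> {v \<in> range ?g. snd v = y}" by (auto simp: image_iff)
      ultimately have "(\<Sum>v | v \<in> range ?g \<and> snd v = y. eta (S v)) = (\<Sum>v\<in>{?v}. eta (S v))"
        by (intro sum.mono_neutral_right fin) (auto simp: eta_def)
      moreover have "S ?v = (\<Sum>w | snd w = y. P w)"
        unfolding S_def by (intro sum.mono_neutral_left) (auto dest: z')
      ultimately show ?thesis by simp
    qed
  qed
  finally have "shannon_H ?g P = shannon_H snd P"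
    by (simp add: shannon_H_eta S_def)
  then show ?thesis by (simp add: trivial_primitive_def dep_cond_entropy_def)
qed

section \<open>Leakage-free embeddings\<close>

text \<open>Regrouping the product of the two Gram matrices, \<open>c d T T\<close>, brings out
  inner products over \<open>b\<close> of rows of \<open>M\<close> and \<open>N\<close>, which
  vanish. As \<open>T\<close> is hermitian, the diagonal of \<open>T T\<close> consists of sums of
  squared moduli, so \<open>T = 0\<close>; its diagonal is, up to \<open>c\<close>, the squared
  norms of the columns of \<open>M\<close>.\<close>

lemma orthogonal_gram_zero:
  fixes M N :: "'a::finite \<Rightarrow> 'b::finite \<Rightarrow> complex" and T :: "'b \<Rightarrow> 'b \<Rightarrow> complex"
  assumes M: "\<And>b b'. (\<Sum>a\<in>UNIV. M a b * cnj (M a b')) = of_real c * T b b'"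
    and N: "\<And>b b'. (\<Sum>a\<in>UNIV. N a b * cnj (N a b')) = of_real d * T b b'"
    and orth: "\<And>a a'. (\<Sum>b\<in>UNIV. M a b * cnj (N a' b)) = 0"
    and cd: "c \<noteq> 0" "d \<noteq> 0"
  shows "M a b = 0"
proof -
  have herm: "T b' b = cnj (T b b')" for b b'
  proof -
    have "of_real c * T b' b = cnj (of_real c * T b b')"
      unfolding M[symmetric] by (simp add: mult.commute)
    then show ?thesis using cd by simp
  qed
  have orth': "(\<Sum>b\<in>UNIV. cnj (M a b) * N a' b) = 0" for a a'
    using arg_cong[OF orth[of a a'], of cnj] by (simp add: mult.commute)
  have "of_real (c * d) * (\<Sum>b'\<in>UNIV. T b b' * cnj (T b b')) = (\<Sum>b'\<in>UNIV. (of_real c * T b b') * (of_real d * T b' b))"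
    unfolding sum_distrib_left herm[of _ b] by (simp add: mult_ac)
  also have "\<dots> = (\<Sum>b'\<in>UNIV. \<Sum>a\<in>UNIV. \<Sum>a'\<in>UNIV. (M a b * cnj (N a' b)) * (cnj (M a b') * N a' b'))"
    unfolding M[symmetric] N[symmetric] sum_product by (simp add: mult_ac)
  also have "\<dots> = (\<Sum>a\<in>UNIV. \<Sum>b'\<in>UNIV. \<Sum>a'\<in>UNIV. (M a b * cnj (N a' b)) * (cnj (M a b') * N a' b'))"
    by (rule sum.swap)
  also have "\<dots> = (\<Sum>a\<in>UNIV. \<Sum>a'\<in>UNIV. \<Sum>b'\<in>UNIV. (M a b * cnj (N a' b)) * (cnj (M a b') * N a' b'))"
    by (rule sum.cong[OF refl]) (rule sum.swap)
  also have "\<dots> = 0"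
    unfolding sum_distrib_left[symmetric] orth' by simp
  finally have "(\<Sum>b'\<in>UNIV. T b b' * cnj (T b b')) = 0" using cd by simp
  then have "complex_of_real (\<Sum>b'\<in>UNIV. (cmod (T b b'))\<^sup>2) = 0"
    by (simp only: of_real_sum complex_norm_square)
  then have "(\<Sum>b'\<in>UNIV. (cmod (T b b'))\<^sup>2) = 0" by (simp only: of_real_eq_0_iff)
  then have "T b b = 0" by (simp add: sum_nonneg_eq_0_iff)
  then have "(\<Sum>a\<in>UNIV. M a b * cnj (M a b)) = 0" by (simp add: M)
  then have "complex_of_real (\<Sum>a\<in>UNIV. (cmod (M a b))\<^sup>2) = 0"
    by (simp only: of_real_sum complex_norm_square)
  then have "(\<Sum>a\<in>UNIV. (cmod (M a b))\<^sup>2) = 0" by (simp only: of_real_eq_0_iff)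
  then show ?thesis by (simp add: sum_nonneg_eq_0_iff)
qed


lemma Re_mult_cnj_self: "Re (z * cnj z) = (cmod z)\<^sup>2"
  unfolding cmod_power2 by (simp add: power2_eq_square)

lemma S_X_S_Y:
  fixes \<psi> :: "('x::finite, 'a::finite, 'y::finite, 'b::finite) qstate"
  assumes "outcome_dist \<psi> P"
  shows "S_X \<psi> = - (\<Sum>x\<in>UNIV. eta (\<Sum>y\<in>UNIV. P (x, y)))"
    and "S_Y \<psi> = - (\<Sum>y\<in>UNIV. eta (\<Sum>x\<in>UNIV. P (x, y)))"
proof -
  have P: "P (x, y) = (\<Sum>a\<in>UNIV. \<Sum>b\<in>UNIV. (cmod (\<psi> (x, a, y, b)))\<^sup>2)" for x y
    using assms by (simp add: outcome_dist_def)
  have "reduced \<psi> (\<lambda>(x,a,y,b). x) (\<lambda>(x,a,y,b). (a,y,b)) (\<lambda>(x,a,y,b). x) x x' =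
      (if x = x' then complex_of_real (\<Sum>y\<in>UNIV. P (x, y)) else 0)" for x x'
  proof -
    have "(\<Sum>y\<in>UNIV. P (x, y)) = (\<Sum>a\<in>UNIV. \<Sum>y\<in>UNIV. \<Sum>b\<in>UNIV. (cmod (\<psi> (x, a, y, b)))\<^sup>2)"
      unfolding P by (rule sum.swap)
    then have "complex_of_real (\<Sum>y\<in>UNIV. P (x, y)) =
        (\<Sum>a\<in>UNIV. \<Sum>y\<in>UNIV. \<Sum>b\<in>UNIV. \<psi> (x, a, y, b) * cnj (\<psi> (x, a, y, b)))"
      by (simp only: of_real_sum complex_norm_square)
    then show ?thesis
      by (subst reduced_eq[where h = "\<lambda>x (a, y, b). (x, a, y, b)"])
        (auto simp: sum_prod_UNIV simp del: of_real_sum)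
  qed
  then show "S_X \<psi> = - (\<Sum>x\<in>UNIV. eta (\<Sum>y\<in>UNIV. P (x, y)))"
    unfolding S_X_def using vn_entropy_diagonal[of "\<lambda>x. \<Sum>y\<in>UNIV. P (x, y)"] by presburger
  have "reduced \<psi> (\<lambda>(x,a,y,b). y) (\<lambda>(x,a,y,b). (x,a,b)) (\<lambda>(x,a,y,b). y) y y' =
      (if y = y' then complex_of_real (\<Sum>x\<in>UNIV. P (x, y)) else 0)" for y y'
    by (subst reduced_eq[where h = "\<lambda>y (x, a, b). (x, a, y, b)"])
      (auto simp: P sum_prod_UNIV complex_norm_square simp del: of_real_power)
  then show "S_Y \<psi> = - (\<Sum>y\<in>UNIV. eta (\<Sum>x\<in>UNIV. P (x, y)))"
    unfolding S_Y_def using vn_entropy_diagonal[of "\<lambda>y. \<Sum>x\<in>UNIV. P (x, y)"] by presburger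
qed

text \<open>\<open>holevo_equality\<close> with label \<open>x\<close>, system \<open>Y B'\<close>
  and block index \<open>y\<close>: the measured information is \<open>I(X;Y)\<close>, and
  \<open>le\<close> keeps the unmeasured one from exceeding it.\<close>

lemma conditional_gram_proportional:
  fixes \<psi> :: "('x::finite, 'a::finite, 'y::finite, 'b::finite) qstate"
  assumes out: "outcome_dist \<psi> P" and le: "MI_X_YB' \<psi> \<le> mutual_info P"
  defines "T \<equiv> \<lambda>y b b'. \<Sum>x\<in>UNIV. \<Sum>a\<in>UNIV. \<psi> (x, a, y, b) * cnj (\<psi> (x, a, y, b'))"
  shows "(\<Sum>a\<in>UNIV. \<psi> (x, a, y, b) * cnj (\<psi> (x, a, y, b'))) =
    of_real (P (x, y) / (\<Sum>x\<in>UNIV. P (x, y))) * T y b b'"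
proof -
  \<comment> \<open>The unnormalised state of \<open>Y B'\<close> given \<open>X = x\<close>; the
    condition on \<open>fst\<close> encodes that \<open>Y\<close> has been measured.\<close>
  define K where "K x q q' = (if fst q = fst q' then
    (\<Sum>a\<in>UNIV. \<psi> (x, a, fst q, snd q) * cnj (\<psi> (x, a, fst q', snd q'))) else 0)" for x and q q' :: "'y \<times> 'b"
  have P: "P (x, y) = (\<Sum>a\<in>UNIV. \<Sum>b\<in>UNIV. (cmod (\<psi> (x, a, y, b)))\<^sup>2)" for x y
    using out by (simp add: outcome_dist_def)
  have psd: "psd (K x)" for x
  proof -
    \<comment> \<open>Adding \<open>y\<close> to the traced index expresses the measurement of
      \<open>Y\<close> as a Gram sum.\<close>
    have "K x q q' = (\<Sum>t\<in>UNIV. (if fst q = snd t then \<psi> (x, fst t, fst q, snd q) else 0)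
        * cnj (if fst q' = snd t then \<psi> (x, fst t, fst q', snd q') else 0))" for q q'
      unfolding sum_prod_UNIV K_def
      by (simp add: if_distrib[of cnj] if_distrib[of "\<lambda>x. _ * x"] if_distrib[of "\<lambda>x. x * _"] cong: if_cong)
    then have "K x = (\<lambda>q q'. \<Sum>t\<in>UNIV. (if fst q = snd t then \<psi> (x, fst t, fst q, snd q) else 0)
        * cnj (if fst q' = snd t then \<psi> (x, fst t, fst q', snd q') else 0))" by (intro ext)
    then show ?thesis by (simp only: psd_gram)
  qed
  have p: "(\<Sum>q | fst q = y. Re (K x q q)) = P (x, y)" for x y
  proof -
    have "(\<Sum>q | fst q = y. Re (K x q q)) = (\<Sum>b\<in>UNIV. \<Sum>a\<in>UNIV. (cmod (\<psi> (x, a, y, b)))\<^sup>2)"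
      unfolding fibre_fst K_def by (simp only: fst_conv snd_conv simp_thms if_True Re_sum Re_mult_cnj_self)
    also have "\<dots> = P (x, y)" unfolding P by (rule sum.swap)
    finally show ?thesis .
  qed
  have R: "reduced \<psi> (\<lambda>(x,a,y,b). (y,b)) (\<lambda>(x,a,y,b). (x,a)) (\<lambda>(x,a,y,b). y)
      = (\<lambda>q q'. \<Sum>x\<in>UNIV. K x q q')"
  proof (intro ext)
    fix q q' :: "'y \<times> 'b"
    show "reduced \<psi> (\<lambda>(x,a,y,b). (y,b)) (\<lambda>(x,a,y,b). (x,a)) (\<lambda>(x,a,y,b). y) q q' = (\<Sum>x\<in>UNIV. K x q q')"
      by (cases q; cases q'; subst reduced_eq[where h = "\<lambda>(y, b) (x, a). (x, a, y, b)"])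
        (auto simp: sum_prod_UNIV K_def intro!: sum.cong)
  qed
  have XYB: "reduced \<psi> (\<lambda>(x,a,y,b). (x,y,b)) (\<lambda>(x,a,y,b). a) (\<lambda>(x,a,y,b). (x,y))
      = (\<lambda>k k'. if fst (id k) = fst (id k') then K (fst (id k)) (snd (id k)) (snd (id k')) else 0)"
  proof (intro ext)
    fix k k' :: "'x \<times> 'y \<times> 'b"
    show "reduced \<psi> (\<lambda>(x,a,y,b). (x,y,b)) (\<lambda>(x,a,y,b). a) (\<lambda>(x,a,y,b). (x,y)) k k'
      = (if fst (id k) = fst (id k') then K (fst (id k)) (snd (id k)) (snd (id k')) else 0)"
      by (subst reduced_eq[where h = "\<lambda>(x, y, b) a. (x, a, y, b)"])
        (auto simp: K_def split_beta)
  qed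
  have "S_XYB' \<psi> = (\<Sum>x\<in>UNIV. vn_entropy (K x))"
    unfolding S_XYB'_def XYB
    by (rule vn_entropy_block_diagonal[OF bij_id]) (use psd in \<open>simp add: psd_def\<close>)
  moreover have "S_YB' \<psi> = vn_entropy (\<lambda>q q'. \<Sum>x\<in>UNIV. K x q q')"
    unfolding S_YB'_def R ..
  ultimately have "vn_entropy (\<lambda>q q'. \<Sum>x\<in>UNIV. K x q q') - (\<Sum>x\<in>UNIV. vn_entropy (K x))
    \<le> (\<Sum>x\<in>UNIV. \<Sum>y\<in>UNIV. eta (P (x, y))) - (\<Sum>y\<in>UNIV. eta (\<Sum>x\<in>UNIV. P (x, y)))"
    using le S_X_S_Y(1)[OF out] by (simp add: MI_X_YB'_def mutual_info_eta)
  then have "K x (y, b) (y, b') = of_real (P (x, y) / (\<Sum>x\<in>UNIV. P (x, y))) * (\<Sum>x\<in>UNIV. K x (y, b) (y, b'))"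
    using holevo_equality[of K fst x "(y, b)" "(y, b')", OF psd] by (simp only: p fst_conv)
  then show ?thesis by (simp add: K_def T_def)
qed

text \<open>\<open>holevo_equality\<close> with label \<open>y\<close>, system \<open>A A'\<close>
  and block index \<open>x\<close> makes each row of \<open>K y\<close> a multiple of that row of
  \<open>R\<close>, by a factor depending only on \<open>x\<close> and \<open>y\<close>.
  \<open>A\<close> is not measured here, so \<open>K y\<close> keeps its entries between
  \<open>x\<close> and \<open>x'\<close>, and hermiticity compares their two factors.\<close>

lemma conditional_vectors_orthogonal:
  fixes \<psi> :: "('x::finite, 'a::finite, 'y::finite, 'b::finite) qstate"
  assumes out: "outcome_dist \<psi> P" and le: "MI_AA'_Y \<psi> \<le> mutual_info P"
    and ne: "dep_fun P x \<noteq> dep_fun P x'"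
  shows "(\<Sum>b\<in>UNIV. \<psi> (x, a, y, b) * cnj (\<psi> (x', a', y, b))) = 0"
proof -
  define K where "K y q q' = (\<Sum>b\<in>UNIV. \<psi> (fst q, snd q, y, b) * cnj (\<psi> (fst q', snd q', y, b)))"
    for y and q q' :: "'x \<times> 'a"
  define R where "R q q' = (\<Sum>y\<in>UNIV. K y q q')" for q q'
  have P: "P (x, y) = (\<Sum>a\<in>UNIV. \<Sum>b\<in>UNIV. (cmod (\<psi> (x, a, y, b)))\<^sup>2)" for x y
    using out by (simp add: outcome_dist_def)
  have psd: "psd (K y)" for y
  proof -
    have "K y = (\<lambda>q q'. \<Sum>b\<in>UNIV. \<psi> (fst q, snd q, y, b) * cnj (\<psi> (fst q', snd q', y, b)))"
      by (intro ext) (rule K_def)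
    then show ?thesis by (simp only: psd_gram)
  qed
  have p: "(\<Sum>q | fst q = x. Re (K y q q)) = P (x, y)" for x y
    unfolding fibre_fst P K_def by (simp only: fst_conv snd_conv Re_sum Re_mult_cnj_self)
  have AA: "reduced \<psi> (\<lambda>(x,a,y,b). (x,a)) (\<lambda>(x,a,y,b). (y,b)) (\<lambda>_. ())
      = (\<lambda>q q'. \<Sum>y\<in>UNIV. K y q q')"
  proof (intro ext)
    fix q q' :: "'x \<times> 'a"
    show "reduced \<psi> (\<lambda>(x,a,y,b). (x,a)) (\<lambda>(x,a,y,b). (y,b)) (\<lambda>_. ()) q q' = (\<Sum>y\<in>UNIV. K y q q')"
      by (subst reduced_eq[where h = "\<lambda>(x, a) (y, b). (x, a, y, b)"])
        (auto simp: sum_prod_UNIV K_def split_beta)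
  qed
  \<comment> \<open>The label \<open>y\<close> is moved to the front to match the form of
    \<open>vn_entropy_block_diagonal\<close>.\<close>
  define \<pi> :: "'x \<times> 'a \<times> 'y \<Rightarrow> 'y \<times> 'x \<times> 'a" where "\<pi> = (\<lambda>(x, a, y). (y, x, a))"
  have "bij \<pi>"
    by (rule bij_betw_byWitness[where f' = "\<lambda>(y, x, a). (x, a, y)"]) (auto simp: \<pi>_def)
  have AAY: "reduced \<psi> (\<lambda>(x,a,y,b). (x,a,y)) (\<lambda>(x,a,y,b). b) (\<lambda>(x,a,y,b). y)
      = (\<lambda>k k'. if fst (\<pi> k) = fst (\<pi> k') then K (fst (\<pi> k)) (snd (\<pi> k)) (snd (\<pi> k')) else 0)"
  proof (intro ext)
    fix k k' :: "'x \<times> 'a \<times> 'y"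
    show "reduced \<psi> (\<lambda>(x,a,y,b). (x,a,y)) (\<lambda>(x,a,y,b). b) (\<lambda>(x,a,y,b). y) k k'
      = (if fst (\<pi> k) = fst (\<pi> k') then K (fst (\<pi> k)) (snd (\<pi> k)) (snd (\<pi> k')) else 0)"
      by (subst reduced_eq[where h = "\<lambda>(x, a, y) b. (x, a, y, b)"])
        (auto simp: K_def \<pi>_def split_beta)
  qed
  have "S_AA'Y \<psi> = (\<Sum>y\<in>UNIV. vn_entropy (K y))"
    unfolding S_AA'Y_def AAY
    by (rule vn_entropy_block_diagonal[OF \<open>bij \<pi>\<close>]) (use psd in \<open>simp add: psd_def\<close>)
  moreover have "S_AA' \<psi> = vn_entropy (\<lambda>q q'. \<Sum>y\<in>UNIV. K y q q')"
    unfolding S_AA'_def AA ..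
  moreover have "(\<Sum>x\<in>UNIV. \<Sum>y\<in>UNIV. eta (P (x, y))) = (\<Sum>y\<in>UNIV. \<Sum>x\<in>UNIV. eta (P (x, y)))"
    by (rule sum.swap)
  ultimately have "vn_entropy (\<lambda>q q'. \<Sum>y\<in>UNIV. K y q q') - (\<Sum>y\<in>UNIV. vn_entropy (K y))
    \<le> (\<Sum>y\<in>UNIV. \<Sum>x\<in>UNIV. eta (P (x, y))) - (\<Sum>x\<in>UNIV. eta (\<Sum>y\<in>UNIV. P (x, y)))"
    using le S_X_S_Y(2)[OF out] by (simp add: MI_AA'_Y_def mutual_info_eta)
  then have eq: "K y q q' = of_real (dep_fun P (fst q) y) * R q q'" for y q q'
    using holevo_equality[of K fst y q q', OF psd] unfolding p by (simp add: dep_fun_def marg_X_def R_def)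
  \<comment> \<open>One \<open>y0\<close> separating the two distributions suffices: it kills the
    entry of \<open>R\<close>, and with it the entry of every \<open>K y\<close>.\<close>
  from ne obtain y0 where y0: "dep_fun P x y0 \<noteq> dep_fun P x' y0" by (auto simp: fun_eq_iff)
  have hK: "K y q' q = cnj (K y q q')" for y q q'
    using psd[of y] unfolding psd_def hermitian_def by blast
  have hR: "R q' q = cnj (R q q')" for q q'
    unfolding R_def cnj_sum by (intro sum.cong refl hK)
  \<comment> \<open>The entry of \<open>K y0\<close> is computed once with the factor of its row and
    once, by conjugating the transposed entry, with that of its column; both factors are
    real.\<close>
  have "of_real (dep_fun P x' y0) * R (x, a) (x', a') = of_real (dep_fun P x y0) * R (x, a) (x', a')"
    using eq[of y0 "(x, a)" "(x', a')"] eq[of y0 "(x', a')" "(x, a)"] hK[of y0 "(x, a)" "(x', a')"]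
      hR[of "(x, a)" "(x', a')"] by (simp add: complex_eq_iff)
  then have "R (x, a) (x', a') = 0" using y0 by auto
  then have "K y (x, a) (x', a') = 0" using eq by simp
  then show ?thesis by (simp add: K_def)
qed

theorem theorem3:
  fixes P :: "'x::finite \<times> 'y::finite \<Rightarrow> real"
    and \<psi> :: "('x, 'a::finite, 'y, 'b::finite) qstate"
  assumes "is_distribution P"
    and "is_embedding P \<psi>"
    and "leakage P \<psi> = 0"
  shows "trivial_primitive P"
proof (rule trivial_primitiveI)
  show nn: "0 \<le> P i" for i using assms(1) unfolding is_distribution_def by blast
  have out: "outcome_dist \<psi> P" and YB: "MI_X_YB' \<psi> \<le> mutual_info P"
    using assms(2) by (simp_all add: is_embedding_def)
  \<comment> \<open>\<open>leakage\<close> is a maximum, so its vanishing bounds the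
    \<open>AA'\<close> term.\<close>
  have AA: "MI_AA'_Y \<psi> \<le> mutual_info P"
    using assms(3) by (simp add: leakage_def max_def split: if_splits)
  fix x x' y
  assume pos: "0 < P (x, y)" "0 < P (x', y)"
  show "dep_fun P x = dep_fun P x'"
  proof (rule ccontr)
    assume ne: "dep_fun P x \<noteq> dep_fun P x'"
    \<comment> \<open>Positivity of \<open>P\<close> at the common \<open>y\<close> enters here: it
      makes both proportionality factors nonzero, as \<open>orthogonal_gram_zero\<close>
      demands.\<close>
    have "0 < (\<Sum>x\<in>UNIV. P (x, y))"
      using pos(1) nn by (intro sum_pos2[of _ x]) auto
    then have c: "P (x, y) / (\<Sum>x\<in>UNIV. P (x, y)) \<noteq> 0" "P (x', y) / (\<Sum>x\<in>UNIV. P (x, y)) \<noteq> 0"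
      using pos by auto
    have "\<psi> (x, a, y, b) = 0" for a b
      by (rule orthogonal_gram_zero[where M = "\<lambda>a b. \<psi> (x, a, y, b)" and N = "\<lambda>a b. \<psi> (x', a, y, b)",
            OF conditional_gram_proportional[OF out YB] conditional_gram_proportional[OF out YB] conditional_vectors_orthogonal[OF out AA ne] c])
    moreover have "P (x, y) = (\<Sum>a\<in>UNIV. \<Sum>b\<in>UNIV. (cmod (\<psi> (x, a, y, b)))\<^sup>2)"
      using out by (simp add: outcome_dist_def)
    ultimately show False using pos(1) by simp
  qed
qed

end
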